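(* Let $\alpha>0$, let $u_l,u_r\in\mathbb R$ and $\rho_l,\rho_r\ge 0$, and suppose that $u_l>u_r$, $\sigma=\frac{u_l+u_r}{2}\in(u_r,u_l)$, and $[\rho u]-\sigma[\rho]>0$. Let $g(x)=\frac1{2\alpha}\exp\left(-\frac{|x|}{\alpha}\right)$ be the Helmholtz filter on $\mathbb R$, and put $u_\delta=\sigma$. Then the pair $(\rho,u)$ given by $$\rho=h+w(s)\delta_{\mathcal C},\qquad h(x,t)=\begin{cases}\rho_l,& x/t<\sigma,\\ \rho_r,& x/t>\sigma,\end{cases}\qquad w(s)=\frac{s}{\sqrt{1+\sigma^2}}\left([\rho u]-\sigma[\rho]\right),$$ $$\mathcal C=\{t=s,\ x=\sigma s:\ 0\le s<\infty\},\qquad u(x,t)=\begin{cases}u_l,& x/t<\sigma,\\ u_\delta,& x/t=\sigma,\\ u_r,& x/t>\sigma,\end{cases}$$ satisfies the Riemann problem $$\rho_t+\overline u\,\rho_x+\overline\rho\,u_x=0,\qquad u_t+\overline u\,u_x=0,\qquad (\rho(x,0),u(x,0))=\begin{cases}(\rho_l,u_l),&x<0,\\(\rho_r,u_r),&x>0,\end{cases}$$ where the $u$-equation is understood in the sense of characteristics and the $\rho$-equation in the sense of distribution solutions.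
   Context: **Notation.** $[q]=q_l-q_r$ denotes the jump; thus $[\rho]=\rho_l-\rho_r$ and $[\rho u]=\rho_lu_l-\rho_ru_r$. $\mathbb R^2_+=\{(x,t):t>0\}$. The bar denotes convolution with $g$ in the variable $x$: $\overline f=g*f$ (so $f=\overline f-\alpha^2\overline f_{xx}$); for the distribution $\rho$, $\overline\rho$ is the distributional convolution in $x$, which is a locally bounded function, weakly differentiable in $x$. **Weighted delta.** For a smooth curve $\mathcal C$ parametrized by $x=x(s)$, $t=t(s)$, $a<s<b$, $$\langle w(s)\delta_{\mathcal C},\psi\rangle=\int_a^b w(s)\psi(x(s),t(s))\sqrt{x'(s)^2+t'(s)^2}\,ds,\qquad \psi\in C_0^\infty(\mathbb R^2_+).$$ **Pairings.** For $\rho=h+w\delta_{\mathcal C}$ as in the claim and $\psi\in C_0^\infty(\mathbb R^2_+)$, $$\langle\rho,\psi\rangle=\iint_{\mathbb R^2_+}h\psi\,dx\,dt+\langle w\delta_{\mathcal C},\psi\rangle,\qquad \langle\rho\overline u,\psi\rangle=\iint_{\mathbb R^2_+}h\overline u\psi\,dx\,dt+\langle w u_\delta\delta_{\mathcal C},\psi\rangle,$$ where $u_\delta$ is the value of $\overline u$ on $\mathcal C$. For functions, $\langle f,\psi\rangle=\iint_{\mathbb R^2_+} f\psi\,dx\,dt$. **Sense of solution.** (a) $u$ solves $u_t+\overline u u_x=0$ with the given initial data in the sense of characteristics: with $\frac{d}{dt}\phi_t(s)=\overline u(\phi_t(s),t)$, $\phi_0(s)=s$, one has $u(\phi_t(s),t)=u(s,0)$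 for all $s\neq0$, $t>0$. (b) $\rho$ is a distribution solution of $\rho_t+\overline u\rho_x+\overline\rho u_x=0$ if for all $\phi\in C_0^\infty(\mathbb R^2_+)$ $$\langle\rho,\phi_t\rangle+\langle\rho\overline u,\phi_x\rangle+\langle\overline\rho(u-\overline u),\phi_x\rangle+\langle\alpha^2\overline\rho_x\overline u_x,\phi_x\rangle=0.$$ The initial data for $\rho$ are taken by $h$ at $t=0$ (with $w(0)=0$). *)

theory Defs
  imports "HOL-Analysis.Analysis"
begin

text \<open>Points of the plane are pairs \<open>(x, t)\<close>; the upper half-plane is open in \<open>t\<close>.\<close>

definition half_plane :: "(real \<times> real) set" where
  "half_plane = {p. snd p > 0}"

definition pd_x :: "(real \<times> real \<Rightarrow> real) \<Rightarrow> real \<times> real \<Rightarrow> real" where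
  "pd_x f = (\<lambda>(x, t). deriv (\<lambda>y. f (y, t)) x)"

definition pd_t :: "(real \<times> real \<Rightarrow> real) \<Rightarrow> real \<times> real \<Rightarrow> real" where
  "pd_t f = (\<lambda>(x, t). deriv (\<lambda>\<tau>. f (x, \<tau>)) t)"

primrec C_k :: "nat \<Rightarrow> (real \<times> real \<Rightarrow> real) \<Rightarrow> bool" where
  "C_k 0 f \<longleftrightarrow> continuous_on UNIV f"
| "C_k (Suc k) f \<longleftrightarrow> f differentiable_on UNIV \<and> C_k k (pd_x f) \<and> C_k k (pd_t f)"

definition test_function :: "(real \<times> real \<Rightarrow> real) \<Rightarrow> bool" where
  "test_function \<psi> \<longleftrightarrow> (\<forall>k. C_k k \<psi>)
     \<and> compact (closure {p. \<psi> p \<noteq> 0}) \<and> closure {p. \<psi> p \<noteq> 0} \<subseteq> half_plane"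

definition loc_integrable :: "(real \<times> real \<Rightarrow> real) \<Rightarrow> bool" where
  "loc_integrable f \<longleftrightarrow> (\<forall>K. compact K \<and> K \<subseteq> half_plane \<longrightarrow> set_integrable lborel K f)"

definition loc_bounded :: "(real \<times> real \<Rightarrow> real) \<Rightarrow> bool" where
  "loc_bounded f \<longleftrightarrow> (\<forall>K. compact K \<and> K \<subseteq> half_plane \<longrightarrow> bounded (f ` K))"

definition fun_pairing :: "(real \<times> real \<Rightarrow> real) \<Rightarrow> (real \<times> real \<Rightarrow> real) \<Rightarrow> real" where
  "fun_pairing f \<psi> = (LINT p:half_plane|lborel. f p * \<psi> p)"

definition weighted_delta ::
  "(real \<Rightarrow> real) \<Rightarrow> (real \<Rightarrow> real) \<Rightarrow> (real \<Rightarrow> real) \<Rightarrow> real set \<Rightarrow> (real \<times> real \<Rightarrow> real) \<Rightarrow> real" where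
  "weighted_delta w X T I \<psi> =
     (LINT s:I|lborel. w s * \<psi> (X s, T s) * sqrt ((deriv X s)\<^sup>2 + (deriv T s)\<^sup>2))"

definition weak_pd_x :: "(real \<times> real \<Rightarrow> real) \<Rightarrow> (real \<times> real \<Rightarrow> real) \<Rightarrow> bool" where
  "weak_pd_x f f' \<longleftrightarrow> loc_integrable f \<and> loc_integrable f'
     \<and> (\<forall>\<psi>. test_function \<psi> \<longrightarrow> fun_pairing f' \<psi> = - fun_pairing f (pd_x \<psi>))"

definition helmholtz :: "real \<Rightarrow> real \<Rightarrow> real" where
  "helmholtz \<alpha> x = 1 / (2 * \<alpha>) * exp (- \<bar>x\<bar> / \<alpha>)"

definition conv_x :: "(real \<Rightarrow> real) \<Rightarrow> (real \<times> real \<Rightarrow> real) \<Rightarrow> real \<times> real \<Rightarrow> real" where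
  "conv_x g f = (\<lambda>(x, t). LINT y|lborel. g (x - y) * f (y, t))"

text \<open>
  The function \<open>R\<close> represents the convolution in \<open>x\<close> of \<open>g\<close> with the distribution \<open>D\<close>,
  i.e. the distribution sending \<open>\<psi>\<close> to the value of \<open>D\<close> at the convolution of \<open>\<psi>\<close> with the
  reflection of \<open>g\<close>. The latter is not compactly supported in \<open>x\<close>, so \<open>D\<close> is taken as a
  functional given by an integral formula that makes sense beyond test functions.
\<close>
definition represents_conv_x ::
  "(real \<Rightarrow> real) \<Rightarrow> ((real \<times> real \<Rightarrow> real) \<Rightarrow> real) \<Rightarrow> (real \<times> real \<Rightarrow> real) \<Rightarrow> bool" where
  "represents_conv_x g D R \<longleftrightarrow> loc_integrable R
     \<and> (\<forall>\<psi>. test_function \<psi> \<longrightarrow> fun_pairing R \<psi> = D (conv_x (\<lambda>z. g (- z)) \<psi>))"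

definition characteristic_flow :: "(real \<times> real \<Rightarrow> real) \<Rightarrow> (real \<Rightarrow> real \<Rightarrow> real) \<Rightarrow> bool" where
  "characteristic_flow v \<phi> \<longleftrightarrow> (\<forall>s. \<phi> 0 s = s \<and>
     (\<forall>t\<ge>0. ((\<lambda>\<tau>. \<phi> \<tau> s) has_real_derivative v (\<phi> t s, t)) (at t within {0..})))"

text \<open>The first conjunct keeps the second one from holding vacuously.\<close>
definition solves_u_by_characteristics ::
  "(real \<Rightarrow> real) \<Rightarrow> (real \<times> real \<Rightarrow> real) \<Rightarrow> bool" where
  "solves_u_by_characteristics g u \<longleftrightarrow>
     (\<exists>\<phi>. characteristic_flow (conv_x g u) \<phi>) \<and>
     (\<forall>\<phi>. characteristic_flow (conv_x g u) \<phi> \<longrightarrow>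
        (\<forall>s t. s \<noteq> 0 \<and> t > 0 \<longrightarrow> u (\<phi> t s, t) = u (s, 0)))"

definition takes_initial_data :: "(real \<times> real \<Rightarrow> real) \<Rightarrow> (real \<Rightarrow> real) \<Rightarrow> bool" where
  "takes_initial_data f f0 \<longleftrightarrow>
     (\<forall>x. x \<noteq> 0 \<longrightarrow> f (x, 0) = f0 x \<and> ((\<lambda>t. f (x, t)) \<longlongrightarrow> f0 x) (at_right 0))"

definition rho_pairing ::
  "(real \<times> real \<Rightarrow> real) \<Rightarrow> (real \<Rightarrow> real) \<Rightarrow> (real \<Rightarrow> real) \<Rightarrow> (real \<Rightarrow> real) \<Rightarrow> real set
    \<Rightarrow> (real \<times> real \<Rightarrow> real) \<Rightarrow> real" where
  "rho_pairing h w X T I \<psi> = fun_pairing h \<psi> + weighted_delta w X T I \<psi>"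

definition rho_ubar_pairing ::
  "(real \<times> real \<Rightarrow> real) \<Rightarrow> (real \<Rightarrow> real) \<Rightarrow> (real \<Rightarrow> real) \<Rightarrow> (real \<Rightarrow> real) \<Rightarrow> real set
    \<Rightarrow> (real \<times> real \<Rightarrow> real) \<Rightarrow> real \<Rightarrow> (real \<times> real \<Rightarrow> real) \<Rightarrow> real" where
  "rho_ubar_pairing h w X T I ub u\<^sub>\<delta> \<psi> =
     fun_pairing (\<lambda>p. h p * ub p) \<psi> + weighted_delta (\<lambda>s. w s * u\<^sub>\<delta>) X T I \<psi>"

text \<open>
  Here \<open>rb\<close> is the filtered density, \<open>rbx\<close> its weak derivative in \<open>x\<close>, and \<open>ubx\<close> that of the
  filtered velocity. All three are determined up to null sets, so the choice of
  representatives does not affect the equation.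
\<close>
definition solves_rho_distributionally ::
  "real \<Rightarrow> (real \<Rightarrow> real) \<Rightarrow> (real \<times> real \<Rightarrow> real) \<Rightarrow> (real \<Rightarrow> real) \<Rightarrow> (real \<Rightarrow> real) \<Rightarrow> (real \<Rightarrow> real)
    \<Rightarrow> real set \<Rightarrow> (real \<times> real \<Rightarrow> real) \<Rightarrow> real \<Rightarrow> bool" where
  "solves_rho_distributionally \<alpha> g h w X T I u u\<^sub>\<delta> \<longleftrightarrow>
     (let ub = conv_x g u in
       (\<forall>s\<in>I. T s > 0 \<longrightarrow> ub (X s, T s) = u\<^sub>\<delta>) \<and>
       (\<exists>rb rbx ubx.
          represents_conv_x g (rho_pairing h w X T I) rb \<and> loc_bounded rb \<and>
          weak_pd_x rb rbx \<and> weak_pd_x ub ubx \<and>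
          loc_integrable h \<and> loc_integrable (\<lambda>p. h p * ub p) \<and>
          loc_integrable (\<lambda>p. rb p * (u p - ub p)) \<and>
          loc_integrable (\<lambda>p. \<alpha>\<^sup>2 * rbx p * ubx p) \<and>
          (\<forall>\<phi>. test_function \<phi> \<longrightarrow>
             rho_pairing h w X T I (pd_t \<phi>)
             + rho_ubar_pairing h w X T I ub u\<^sub>\<delta> (pd_x \<phi>)
             + fun_pairing (\<lambda>p. rb p * (u p - ub p)) (pd_x \<phi>)
             + fun_pairing (\<lambda>p. \<alpha>\<^sup>2 * rbx p * ubx p) (pd_x \<phi>) = 0)))"

text \<open>
  The conditions \<open>x/t < \<sigma>\<close> and \<open>x/t = \<sigma>\<close> are multiplied out: this is the same for \<open>t > 0\<close>, and
  at \<open>t = 0\<close> it avoids the value of division by zero and reads \<open>x/t\<close> as \<open>\<plusminus>\<infinity>\<close>. The value of the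
  density on the line \<open>x = \<sigma> t\<close> (a null set) is immaterial.
\<close>
definition rho_regular :: "real \<Rightarrow> real \<Rightarrow> real \<Rightarrow> real \<times> real \<Rightarrow> real" where
  "rho_regular \<rho>\<^sub>l \<rho>\<^sub>r \<sigma> = (\<lambda>(x, t). if x < \<sigma> * t then \<rho>\<^sub>l else \<rho>\<^sub>r)"

definition velocity :: "real \<Rightarrow> real \<Rightarrow> real \<Rightarrow> real \<Rightarrow> real \<times> real \<Rightarrow> real" where
  "velocity u\<^sub>l u\<^sub>r u\<^sub>\<delta> \<sigma> =
     (\<lambda>(x, t). if x < \<sigma> * t then u\<^sub>l else if x = \<sigma> * t then u\<^sub>\<delta> else u\<^sub>r)"

definition riemann_data :: "real \<Rightarrow> real \<Rightarrow> real \<Rightarrow> real" where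
  "riemann_data q\<^sub>l q\<^sub>r x = (if x < 0 then q\<^sub>l else q\<^sub>r)"

end

theory Submission
  imports Defs
begin

text \<open>
  Everything depends on \<open>z = x - \<sigma> t\<close>, the horizontal offset from the jump line. Let \<open>W\<close> be the
  filtered sign function (the definition \<open>saturation\<close>). The filter turns a step with values
  \<open>A\<close>, \<open>C\<close> into \<open>(A + C) / 2 - (A - C) / 2 * W z\<close>, so the filtered velocity is
  \<open>\<sigma> - (u\<^sub>l - u\<^sub>r) / 2 * W z\<close>, because \<open>\<sigma>\<close> is the mean of \<open>u\<^sub>l\<close> and \<open>u\<^sub>r\<close>.

  Velocity. Relative to the line a particle obeys \<open>z' = - (u\<^sub>l - u\<^sub>r) / 2 * W z\<close>. The line itself is a
  trajectory, and \<open>W\<close> grows at most linearly away from \<open>0\<close>, so every other trajectory decays to the line at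
  most exponentially fast and stays on its side of it for all time. Hence \<open>u\<close> is constant along
  trajectories (\<open>velocity_solves_by_characteristics\<close>).

  Density. The filtered density is the filtered step plus \<open>m t g z\<close>, where
  \<open>m = (\<rho>\<^sub>l u\<^sub>l - \<rho>\<^sub>r u\<^sub>r) - \<sigma> (\<rho>\<^sub>l - \<rho>\<^sub>r)\<close> is the growth rate of the delta (\<open>represents_conv_x_rho\<close>).
  Away from the line all exponentials in the three fluxes of the equation cancel and their sum is the unfiltered flux, \<open>\<rho>\<^sub>l u\<^sub>l\<close> or \<open>\<rho>\<^sub>r u\<^sub>r\<close>
  (\<open>filtered_fluxes_cancel\<close>). The equation thereby reduces to the conservation law
  \<open>\<rho>\<^sub>t + (\<rho> u)\<^sub>x = 0\<close> for a step with a delta on its jump line, and this holds because the delta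
  grows at the rate by which the step violates the Rankine-Hugoniot condition, which is \<open>m\<close>
  (\<open>delta_shock_weak_form\<close>).
\<close>

section \<open>The filter and its response to a step\<close>

text \<open>
  This is \<open>g * sgn\<close> for the Helmholtz filter \<open>g\<close>, i.e. \<open>sgn z * (1 - exp (- \<bar>z\<bar> / \<alpha>))\<close>. Written
  with \<open>min\<close> and \<open>max\<close> it is visibly continuous at \<open>0\<close>.
\<close>
definition saturation :: "real \<Rightarrow> real \<Rightarrow> real" where
  "saturation \<alpha> z = exp (min z 0 / \<alpha>) - exp (- max z 0 / \<alpha>)"

lemma saturation_nonneg: "z \<ge> 0 \<Longrightarrow> saturation \<alpha> z = 1 - exp (- z / \<alpha>)"
  and saturation_nonpos: "z \<le> 0 \<Longrightarrow> saturation \<alpha> z = exp (z / \<alpha>) - 1"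
  by (auto simp: saturation_def)

lemma saturation_0 [simp]: "saturation \<alpha> 0 = 0"
  by (simp add: saturation_def)

lemma saturation_minus: "saturation \<alpha> (- z) = - saturation \<alpha> z"
  by (simp add: saturation_def min_def max_def)

lemma continuous_on_saturation [continuous_intros]:
  "continuous_on S f \<Longrightarrow> continuous_on S (\<lambda>x. saturation \<alpha> (f x))"
  unfolding saturation_def
  by (cases "\<alpha> = 0") (auto intro!: continuous_intros)

lemma saturation_has_derivative:
  assumes "z \<noteq> 0"
  shows "(saturation \<alpha> has_real_derivative exp (- \<bar>z\<bar> / \<alpha>) / \<alpha>) (at z)"
proof (cases "z > 0")
  case True
  have "((\<lambda>z. 1 - exp (- z / \<alpha>)) has_real_derivative exp (- \<bar>z\<bar> / \<alpha>) / \<alpha>) (at z)"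
    using True by (cases "\<alpha> = 0") (auto intro!: derivative_eq_intros)
  then show ?thesis
    by (rule has_field_derivative_transform_within_open[where S="{0<..}"])
       (use True in \<open>auto simp: saturation_nonneg\<close>)
next
  case False
  have "((\<lambda>z. exp (z / \<alpha>) - 1) has_real_derivative exp (- \<bar>z\<bar> / \<alpha>) / \<alpha>) (at z)"
    using False by (cases "\<alpha> = 0") (auto intro!: derivative_eq_intros)
  then show ?thesis
    by (rule has_field_derivative_transform_within_open[where S="{..<0}"])
       (use False assms in \<open>auto simp: saturation_nonpos\<close>)
qed

lemma exp_abs_has_derivative:
  fixes z :: real
  assumes "z \<noteq> 0"
  shows "((\<lambda>z. exp (- \<bar>z\<bar> / \<alpha>)) has_real_derivative - sgn z * exp (- \<bar>z\<bar> / \<alpha>) / \<alpha>) (at z)"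
proof (cases "z > 0")
  case True
  have "((\<lambda>z. exp (- z / \<alpha>)) has_real_derivative - sgn z * exp (- \<bar>z\<bar> / \<alpha>) / \<alpha>) (at z)"
    using True by (cases "\<alpha> = 0") (auto intro!: derivative_eq_intros)
  then show ?thesis
    by (rule has_field_derivative_transform_within_open[where S="{0<..}"])
       (use True in auto)
next
  case False
  have "((\<lambda>z. exp (z / \<alpha>)) has_real_derivative - sgn z * exp (- \<bar>z\<bar> / \<alpha>) / \<alpha>) (at z)"
    using False assms by (cases "\<alpha> = 0") (auto intro!: derivative_eq_intros)
  then show ?thesis
    by (rule has_field_derivative_transform_within_open[where S="{..<0}"])
       (use False assms in auto)
qed

text \<open>
  Convexity of \<open>exp\<close>. This bounds the speed at which trajectories can approach the jump line.
\<close>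
lemma saturation_growth:
  assumes "\<alpha> > 0"
  shows "z * saturation \<alpha> z \<le> z\<^sup>2 / \<alpha>"
proof (cases "z \<ge> 0")
  case True
  have "1 - exp (- z / \<alpha>) \<le> z / \<alpha>"
    using exp_ge_add_one_self[of "- z / \<alpha>"] by simp
  from mult_left_mono[OF this True] show ?thesis
    using True by (simp add: saturation_nonneg power2_eq_square)
next
  case False
  have "z / \<alpha> \<le> exp (z / \<alpha>) - 1"
    using exp_ge_add_one_self[of "z / \<alpha>"] by linarith
  from mult_left_mono_neg[OF this, of z] show ?thesis
    using False by (simp add: saturation_nonpos power2_eq_square)
qed

lemma borel_measurable_helmholtz [measurable]: "helmholtz \<alpha> \<in> borel_measurable borel"
  unfolding helmholtz_def by measurable

lemma helmholtz_minus [simp]: "helmholtz \<alpha> (- x) = helmholtz \<alpha> x"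
  by (simp add: helmholtz_def)

lemma helmholtz_nonneg: "\<alpha> > 0 \<Longrightarrow> 0 \<le> helmholtz \<alpha> x"
  by (simp add: helmholtz_def)

lemma helmholtz_upper_tail:
  assumes "\<alpha> > 0" "b \<ge> 0"
  shows "has_bochner_integral lborel (\<lambda>z. helmholtz \<alpha> z * indicator {b..} z) (exp (- b / \<alpha>) / 2)"
proof -
  have "(\<integral>\<^sup>+z. ennreal (helmholtz \<alpha> z) * indicator {b..} z \<partial>lborel)
      = ennreal (0 - (- exp (- b / \<alpha>) / 2))"
  proof (rule nn_integral_FTC_atLeast[where F="\<lambda>z. - exp (- z / \<alpha>) / 2"])
    fix z assume "b \<le> z"
    then show "((\<lambda>z. - exp (- z / \<alpha>) / 2) has_real_derivative helmholtz \<alpha> z) (at z)"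
      using assms by (auto intro!: derivative_eq_intros simp: helmholtz_def field_simps)
  next
    have decay: "LIM z at_top. - z / \<alpha> :> at_bot"
      using filterlim_tendsto_pos_mult_at_bot[OF tendsto_const, of "1 / \<alpha>" uminus at_top]
        filterlim_uminus_at_bot_at_top assms by simp
    have "((\<lambda>z. - exp (- z / \<alpha>) / 2) \<longlongrightarrow> - 0 / 2) at_top"
      by (intro tendsto_intros filterlim_compose[OF exp_at_bot] decay) auto
    then show "((\<lambda>z. - exp (- z / \<alpha>) / 2) \<longlongrightarrow> 0) at_top" by simp
  qed (auto simp: helmholtz_nonneg assms)
  then have "(\<integral>\<^sup>+z. ennreal (helmholtz \<alpha> z * indicator {b..} z) \<partial>lborel) = ennreal (exp (- b / \<alpha>) / 2)"
    by (simp add: ennreal_mult' ennreal_indicator helmholtz_nonneg assms)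
  then show ?thesis
    by (intro has_bochner_integral_nn_integral) (auto simp: helmholtz_nonneg assms)
qed

lemma helmholtz_lower_tail:
  assumes "\<alpha> > 0" "b \<le> 0"
  shows "has_bochner_integral lborel (\<lambda>z. helmholtz \<alpha> z * indicator {..b} z) (exp (b / \<alpha>) / 2)"
proof -
  have "has_bochner_integral lborel (\<lambda>z. helmholtz \<alpha> z * indicator {- b..} z) (exp (b / \<alpha>) / 2)"
    using helmholtz_upper_tail[of \<alpha> "- b"] assms by simp
  then have "has_bochner_integral lborel
      (\<lambda>z. helmholtz \<alpha> (0 + - 1 * z) * indicator {- b..} (0 + - 1 * z))
      ((exp (b / \<alpha>) / 2) /\<^sub>R \<bar>- 1\<bar>)"
    by (subst lborel_has_bochner_integral_real_affine_iff[symmetric]) auto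
  moreover have "indicator {- b..} (0 + - 1 * z) = (indicator {..b} z :: real)" for z
    by (auto simp: indicator_def)
  ultimately show ?thesis by simp
qed

lemma helmholtz_mass:
  assumes "\<alpha> > 0"
  shows "has_bochner_integral lborel (helmholtz \<alpha>) 1"
proof -
  have "has_bochner_integral lborel
      (\<lambda>z. helmholtz \<alpha> z * indicator {..0} z + helmholtz \<alpha> z * indicator {0..} z) (1/2 + 1/2)"
    using helmholtz_upper_tail[of \<alpha> 0] helmholtz_lower_tail[of \<alpha> 0] assms
    by (intro has_bochner_integral_add) auto
  moreover have "AE z in lborel. helmholtz \<alpha> z * indicator {..0} z + helmholtz \<alpha> z * indicator {0..} z
      = helmholtz \<alpha> z"
    using AE_lborel_singleton[of 0] by eventually_elim (auto simp: indicator_def)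
  ultimately show ?thesis
    by (subst has_bochner_integral_cong_AE[symmetric]) auto
qed

lemma conv_x_eq_shifted: "conv_x g f (x, t) = (LINT z|lborel. g z * f (x - z, t))"
  unfolding conv_x_def
  using lborel_integral_real_affine[of "-1" "\<lambda>y. g (x - y) * f (y, t)" x] by simp

text \<open>
  In the integral \<open>\<integral> g z * f (x - z)\<close> the far side of the jump contributes only an exponential tail of
  \<open>g\<close>; the total mass \<open>1\<close> of \<open>g\<close> takes care of the near side.
\<close>
lemma conv_x_helmholtz_step:
  assumes "\<alpha> > 0"
    and meas: "(\<lambda>y. f (y, t)) \<in> borel_measurable borel"
    and left: "\<And>y. y < a \<Longrightarrow> f (y, t) = A" and right: "\<And>y. y > a \<Longrightarrow> f (y, t) = C"
  shows "conv_x (helmholtz \<alpha>) f (x, t) = (A + C) / 2 - (A - C) / 2 * saturation \<alpha> (x - a)"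
proof -
  have [measurable]: "(\<lambda>z. f (x - z, t)) \<in> borel_measurable borel"
    using measurable_compose[OF _ meas, of "\<lambda>z. x - z" borel] by simp
  show ?thesis
  proof (cases "x \<ge> a")
    case True
    have "conv_x (helmholtz \<alpha>) f (x, t)
        = (LINT z|lborel. C * helmholtz \<alpha> z + (A - C) * (helmholtz \<alpha> z * indicator {x - a..} z))"
      unfolding conv_x_eq_shifted
    proof (rule integral_cong_AE)
      show "AE z in lborel. helmholtz \<alpha> z * f (x - z, t)
          = C * helmholtz \<alpha> z + (A - C) * (helmholtz \<alpha> z * indicator {x - a..} z)"
        using AE_lborel_singleton[of "x - a"]
      proof eventually_elim
        case (elim z)
        then consider "x - z < a" | "x - z > a" by fastforce
        then show ?case
          by cases (auto simp: left right algebra_simps)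
      qed
    qed measurable
    also have "\<dots> = C * 1 + (A - C) * (exp (- (x - a) / \<alpha>) / 2)"
      using True assms(1)
      by (intro has_bochner_integral_integral_eq has_bochner_integral_add
          has_bochner_integral_mult_right helmholtz_mass helmholtz_upper_tail) auto
    finally show ?thesis
      using True by (simp add: saturation_nonneg field_simps)
  next
    case False
    have "conv_x (helmholtz \<alpha>) f (x, t)
        = (LINT z|lborel. A * helmholtz \<alpha> z + (C - A) * (helmholtz \<alpha> z * indicator {..x - a} z))"
      unfolding conv_x_eq_shifted
    proof (rule integral_cong_AE)
      show "AE z in lborel. helmholtz \<alpha> z * f (x - z, t)
          = A * helmholtz \<alpha> z + (C - A) * (helmholtz \<alpha> z * indicator {..x - a} z)"
        using AE_lborel_singleton[of "x - a"]
      proof eventually_elim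
        case (elim z)
        then consider "x - z < a" | "x - z > a" by fastforce
        then show ?case
          by cases (auto simp: left right algebra_simps)
      qed
    qed measurable
    also have "\<dots> = A * 1 + (C - A) * (exp ((x - a) / \<alpha>) / 2)"
      using False assms(1)
      by (intro has_bochner_integral_integral_eq has_bochner_integral_add
          has_bochner_integral_mult_right helmholtz_mass helmholtz_lower_tail) auto
    finally show ?thesis
      using False by (simp add: saturation_nonpos field_simps)
  qed
qed

section \<open>Characteristics\<close>

text \<open>
  In the coordinate \<open>y = exp (\<bar>z\<bar> / \<alpha>) - 1\<close> the equation \<open>z' = - d * W z\<close> becomes the linear equation
  \<open>y' = - (d / \<alpha>) y\<close>; solving it and transforming back gives this formula.
\<close>
lemma relaxing_flow:
  assumes "\<alpha> > 0"
  shows "characteristic_flow (\<lambda>(x, t). \<sigma> - d * saturation \<alpha> (x - \<sigma> * t))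
    (\<lambda>t s. \<sigma> * t + sgn s * (\<alpha> * ln (1 + (exp (\<bar>s\<bar> / \<alpha>) - 1) * exp (- d * t / \<alpha>))))"
  unfolding characteristic_flow_def
proof (intro allI conjI impI)
  fix s :: real
  have "sgn s * \<bar>s\<bar> = s"
    by (simp add: sgn_if)
  then show "\<sigma> * 0 + sgn s * (\<alpha> * ln (1 + (exp (\<bar>s\<bar> / \<alpha>) - 1) * exp (- d * 0 / \<alpha>))) = s"
    using assms by simp
next
  fix s t :: real assume "t \<ge> 0"
  define q where "q t = (exp (\<bar>s\<bar> / \<alpha>) - 1) * exp (- d * t / \<alpha>)" for t
  have q: "q t \<ge> 0" for t
    using assms by (simp add: q_def)
  have "(q has_real_derivative q t * (- d / \<alpha>)) (at t within {0..})"
    unfolding q_def using assms by (auto intro!: derivative_eq_intros)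
  then have "((\<lambda>\<tau>. \<sigma> * \<tau> + sgn s * (\<alpha> * ln (1 + q \<tau>))) has_real_derivative
      \<sigma> + sgn s * (\<alpha> * (q t * (- d / \<alpha>) / (1 + q t)))) (at t within {0..})"
    using q[of t] by (auto intro!: derivative_eq_intros)
  moreover have "saturation \<alpha> (sgn s * (\<alpha> * ln (1 + q t))) = sgn s * (q t / (1 + q t))"
  proof -
    have "saturation \<alpha> (\<alpha> * ln (1 + q t)) = 1 - inverse (1 + q t)"
      using q[of t] assms by (simp add: saturation_nonneg exp_minus)
    also have "\<dots> = q t / (1 + q t)"
      using q[of t] by (simp add: field_simps)
    finally show ?thesis
      by (auto simp: sgn_if saturation_minus)
  qed
  ultimately show "((\<lambda>\<tau>. \<sigma> * \<tau> + sgn s * (\<alpha> * ln (1 + (exp (\<bar>s\<bar> / \<alpha>) - 1) * exp (- d * \<tau> / \<alpha>))))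
      has_real_derivative (case (\<sigma> * t + sgn s * (\<alpha> * ln (1 + (exp (\<bar>s\<bar> / \<alpha>) - 1) * exp (- d * t / \<alpha>))), t)
        of (x, t) \<Rightarrow> \<sigma> - d * saturation \<alpha> (x - \<sigma> * t))) (at t within {0..})"
    using assms by (simp add: q_def mult_ac)
qed

text \<open>
  A backward Gronwall estimate: by \<open>saturation_growth\<close> the quantity \<open>z\<^sup>2 * exp (2 d t / \<alpha>)\<close> is
  nondecreasing, so a trajectory that starts off the line never meets it.
\<close>
lemma characteristic_keeps_side:
  assumes "\<alpha> > 0" "d \<ge> 0"
    and flow: "characteristic_flow (\<lambda>(x, t). \<sigma> - d * saturation \<alpha> (x - \<sigma> * t)) \<phi>"
    and "t \<ge> 0"
  shows "s > 0 \<Longrightarrow> \<phi> t s > \<sigma> * t" and "s < 0 \<Longrightarrow> \<phi> t s < \<sigma> * t"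
proof -
  define z where "z \<tau> = \<phi> \<tau> s - \<sigma> * \<tau>" for \<tau>
  have z0: "z 0 = s"
    using flow by (auto simp: characteristic_flow_def z_def)
  have z': "(z has_real_derivative - d * saturation \<alpha> (z \<tau>)) (at \<tau> within {0..})" if "\<tau> \<ge> 0" for \<tau>
  proof -
    have "((\<lambda>\<tau>. \<phi> \<tau> s) has_real_derivative \<sigma> - d * saturation \<alpha> (\<phi> \<tau> s - \<sigma> * \<tau>)) (at \<tau> within {0..})"
      using flow that by (auto simp: characteristic_flow_def)
    then show ?thesis
      unfolding z_def by (auto intro!: derivative_eq_intros)
  qed
  have cont: "continuous_on {0..} z"
    by (rule DERIV_continuous_on) (rule z', simp)
  have "z \<tau> \<noteq> 0" if "\<tau> \<ge> 0" "s \<noteq> 0" for \<tau>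
  proof -
    \<comment> \<open>The exponential weight compensates the fastest possible decay of \<open>z\<^sup>2\<close>.\<close>
    define N where "N \<tau> = (z \<tau>)\<^sup>2 * exp (2 * d * \<tau> / \<alpha>)" for \<tau>
    have "N 0 \<le> N \<tau>"
    proof (rule DERIV_nonneg_imp_increasing_open[OF that(1)])
      fix r assume r: "0 < r" "r < \<tau>"
      have zr: "(z has_real_derivative - d * saturation \<alpha> (z r)) (at r)"
        using z'[of r] r at_within_interior[of r "{0..}"] by simp
      have "(N has_real_derivative
          2 * d * exp (2 * d * r / \<alpha>) * ((z r)\<^sup>2 / \<alpha> - z r * saturation \<alpha> (z r))) (at r)"
        unfolding N_def
        using assms(1) by (auto intro!: derivative_eq_intros zr simp: power2_eq_square field_simps)
      moreover have "2 * d * exp (2 * d * r / \<alpha>) * ((z r)\<^sup>2 / \<alpha> - z r * saturation \<alpha> (z r)) \<ge> 0"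
        using saturation_growth[OF assms(1), of "z r"] assms(2) by simp
      ultimately show "\<exists>y. (N has_real_derivative y) (at r) \<and> 0 \<le> y" by blast
    next
      show "continuous_on {0..\<tau>} N"
        unfolding N_def using assms
        by (auto intro!: continuous_intros continuous_on_subset[OF cont])
    qed
    then show ?thesis
      using that z0 by (auto simp: N_def)
  qed
  note nonzero = this
  show "\<phi> t s > \<sigma> * t" if s: "s > 0"
  proof (rule ccontr)
    assume "\<not> \<phi> t s > \<sigma> * t"
    then obtain r where "0 \<le> r" "r \<le> t" "z r = 0"
      using IVT2'[of z t 0 0] z0 s \<open>t \<ge> 0\<close> continuous_on_subset[OF cont, of "{0..t}"]
      by (auto simp: z_def)
    with nonzero s show False by auto
  qed
  show "\<phi> t s < \<sigma> * t" if s: "s < 0"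
  proof (rule ccontr)
    assume "\<not> \<phi> t s < \<sigma> * t"
    then obtain r where "0 \<le> r" "r \<le> t" "z r = 0"
      using IVT'[of z 0 0 t] z0 s \<open>t \<ge> 0\<close> continuous_on_subset[OF cont, of "{0..t}"]
      by (auto simp: z_def)
    with nonzero s show False by auto
  qed
qed

lemma conv_x_velocity:
  assumes "\<alpha> > 0" "\<sigma> = (u\<^sub>l + u\<^sub>r) / 2"
  shows "conv_x (helmholtz \<alpha>) (velocity u\<^sub>l u\<^sub>r u\<^sub>\<delta> \<sigma>)
    = (\<lambda>(x, t). \<sigma> - (u\<^sub>l - u\<^sub>r) / 2 * saturation \<alpha> (x - \<sigma> * t))"
proof (intro ext, clarify)
  fix x t
  show "conv_x (helmholtz \<alpha>) (velocity u\<^sub>l u\<^sub>r u\<^sub>\<delta> \<sigma>) (x, t)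
    = \<sigma> - (u\<^sub>l - u\<^sub>r) / 2 * saturation \<alpha> (x - \<sigma> * t)"
    unfolding assms(2)
    by (rule conv_x_helmholtz_step[OF assms(1)]) (auto simp: velocity_def)
qed

lemma velocity_solves_by_characteristics:
  assumes "\<alpha> > 0" "u\<^sub>l \<ge> u\<^sub>r" "\<sigma> = (u\<^sub>l + u\<^sub>r) / 2"
  shows "solves_u_by_characteristics (helmholtz \<alpha>) (velocity u\<^sub>l u\<^sub>r u\<^sub>\<delta> \<sigma>)"
  unfolding solves_u_by_characteristics_def conv_x_velocity[OF assms(1,3)]
proof (intro conjI allI impI)
  show "\<exists>\<phi>. characteristic_flow (\<lambda>(x, t). \<sigma> - (u\<^sub>l - u\<^sub>r) / 2 * saturation \<alpha> (x - \<sigma> * t)) \<phi>"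
    using relaxing_flow[OF assms(1)] by blast
next
  fix \<phi> s t
  assume flow: "characteristic_flow (\<lambda>(x, t). \<sigma> - (u\<^sub>l - u\<^sub>r) / 2 * saturation \<alpha> (x - \<sigma> * t)) \<phi>"
    and st: "s \<noteq> (0::real) \<and> t > (0::real)"
  have d: "(u\<^sub>l - u\<^sub>r) / 2 \<ge> 0" using assms(2) by simp
  show "velocity u\<^sub>l u\<^sub>r u\<^sub>\<delta> \<sigma> (\<phi> t s, t) = velocity u\<^sub>l u\<^sub>r u\<^sub>\<delta> \<sigma> (s, 0)"
    using characteristic_keeps_side[OF assms(1) d flow, of t s] st
    by (cases "s > 0") (auto simp: velocity_def)
qed

section \<open>Test functions, iterated integrals and weak derivatives\<close>

text \<open>
  The part of being a test function that survives differentiation and shearing and is all that the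
  integrals require.
\<close>
definition test_like :: "(real \<times> real \<Rightarrow> real) \<Rightarrow> bool" where
  "test_like \<psi> \<longleftrightarrow> continuous_on UNIV \<psi>
     \<and> (\<exists>R. \<forall>x t. \<psi> (x, t) \<noteq> 0 \<longrightarrow> \<bar>x\<bar> \<le> R \<and> 0 < t \<and> t \<le> R)"

lemma partial_derivatives_of_derivative:
  assumes "(f has_derivative L) (at (x, t))"
  shows "((\<lambda>y. f (y, t)) has_real_derivative L (1, 0)) (at x)" "pd_x f (x, t) = L (1, 0)"
    and "((\<lambda>\<tau>. f (x, \<tau>)) has_real_derivative L (0, 1)) (at t)" "pd_t f (x, t) = L (0, 1)"
proof -
  interpret L: bounded_linear L
    using assms by (rule has_derivative_bounded_linear)
  have "((\<lambda>y. f (y, t)) has_derivative (\<lambda>h. L (h, 0))) (at x)"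
    by (rule has_derivative_compose[of "\<lambda>y. (y, t)" "\<lambda>h. (h, 0)" x UNIV f L])
       (auto intro!: derivative_eq_intros assms)
  moreover have "(\<lambda>h. L (h, 0)) = (*) (L (1, 0))"
  proof
    show "L (h, 0) = L (1, 0) * h" for h
      using L.scaleR[of h "(1, 0)"] by simp
  qed
  ultimately show x: "((\<lambda>y. f (y, t)) has_real_derivative L (1, 0)) (at x)"
    by (simp add: has_field_derivative_def)
  have "((\<lambda>\<tau>. f (x, \<tau>)) has_derivative (\<lambda>h. L (0, h))) (at t)"
    by (rule has_derivative_compose[of "\<lambda>\<tau>. (x, \<tau>)" "\<lambda>h. (0, h)" t UNIV f L])
       (auto intro!: derivative_eq_intros assms)
  moreover have "(\<lambda>h. L (0, h)) = (*) (L (0, 1))"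
  proof
    show "L (0, h) = L (0, 1) * h" for h
      using L.scaleR[of h "(0, 1)"] by simp
  qed
  ultimately show t: "((\<lambda>\<tau>. f (x, \<tau>)) has_real_derivative L (0, 1)) (at t)"
    by (simp add: has_field_derivative_def)
  show "pd_x f (x, t) = L (1, 0)" "pd_t f (x, t) = L (0, 1)"
    using x t by (auto simp: pd_x_def pd_t_def intro: DERIV_imp_deriv)
qed

lemma has_derivative_along_line:
  assumes "f differentiable (at (a + b * s, c + e * s))"
  shows "((\<lambda>s. f (a + b * s, c + e * s)) has_real_derivative
    b * pd_x f (a + b * s, c + e * s) + e * pd_t f (a + b * s, c + e * s)) (at s)"
proof -
  from assms obtain L where L: "(f has_derivative L) (at (a + b * s, c + e * s))"
    by (auto simp: differentiable_def)
  interpret L: bounded_linear L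
    using L by (rule has_derivative_bounded_linear)
  have "((\<lambda>s. f (a + b * s, c + e * s)) has_derivative (\<lambda>h. L (b * h, e * h))) (at s)"
    by (rule has_derivative_compose[of "\<lambda>s. (a + b * s, c + e * s)" "\<lambda>h. (b * h, e * h)" s UNIV f L])
       (auto intro!: derivative_eq_intros L)
  moreover have "(\<lambda>h. L (b * h, e * h)) = (*) (b * L (1, 0) + e * L (0, 1))"
  proof
    show "L (b * h, e * h) = (b * L (1, 0) + e * L (0, 1)) * h" for h
      using L.add[of "(b * h, 0)" "(0, e * h)"] L.scaleR[of "b * h" "(1, 0)"]
        L.scaleR[of "e * h" "(0, 1)"]
      by (simp add: algebra_simps)
  qed
  ultimately show ?thesis
    by (simp add: has_field_derivative_def partial_derivatives_of_derivative[OF L])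
qed

lemma test_function_differentiable: "test_function \<phi> \<Longrightarrow> \<phi> differentiable (at p)"
  unfolding test_function_def
  by (elim conjE allE[of _ "Suc 0"]) (cases p, auto simp: differentiable_on_def)

text \<open>
  Off the closed support \<open>\<phi>\<close> vanishes in a whole neighbourhood, hence so do its partial derivatives.
\<close>
lemma test_function_test_like:
  assumes "test_function \<phi>"
  shows "test_like \<phi>" "test_like (pd_x \<phi>)" "test_like (pd_t \<phi>)"
proof -
  let ?K = "closure {p. \<phi> p \<noteq> 0}"
  have C: "C_k (Suc 0) \<phi>" "C_k 0 \<phi>" and K: "compact ?K" "?K \<subseteq> half_plane"
    using assms by (auto simp: test_function_def simp del: C_k.simps)
  obtain R where R: "\<And>p. p \<in> ?K \<Longrightarrow> norm p \<le> R"
    using compact_imp_bounded[OF K(1)] by (auto simp: bounded_iff)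
  have box: "\<bar>x\<bar> \<le> R \<and> 0 < t \<and> t \<le> R" if "(x, t) \<in> ?K" for x t
    using R[OF that] K(2) that norm_fst_le[of x t] norm_snd_le[of t x]
    by (fastforce simp: half_plane_def)
  have zero: "\<phi> p = 0" "pd_x \<phi> p = 0" "pd_t \<phi> p = 0" if "p \<notin> ?K" for p
  proof -
    have "(\<phi> has_derivative (\<lambda>_. 0)) (at p)"
      by (rule has_derivative_transform_within_open[where f="\<lambda>_. 0" and s="- ?K"])
         (use that closure_subset[of "{p. \<phi> p \<noteq> 0}"] in auto)
    then show "pd_x \<phi> p = 0" "pd_t \<phi> p = 0"
      using partial_derivatives_of_derivative[of \<phi> "\<lambda>_. 0" "fst p" "snd p"] by auto
    show "\<phi> p = 0"
      using that closure_subset[of "{p. \<phi> p \<noteq> 0}"] by auto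
  qed
  have "continuous_on UNIV \<phi>" "continuous_on UNIV (pd_x \<phi>)" "continuous_on UNIV (pd_t \<phi>)"
    using C by simp_all
  then show "test_like \<phi>" "test_like (pd_x \<phi>)" "test_like (pd_t \<phi>)"
    unfolding test_like_def using zero box by blast+
qed

text \<open>
  Measurable functions with a continuous majorant: locally bounded, and closed under sums and products.
  All the coefficients of the equation are of this kind.
\<close>
definition tame :: "(real \<times> real \<Rightarrow> real) \<Rightarrow> bool" where
  "tame f \<longleftrightarrow> f \<in> borel_measurable borel \<and> (\<exists>C. continuous_on UNIV C \<and> (\<forall>p. \<bar>f p\<bar> \<le> C p))"

lemma tame_continuous: "continuous_on UNIV f \<Longrightarrow> tame f"
  unfolding tame_def
  by (intro conjI borel_measurable_continuous_onI exI[of _ "\<lambda>p. \<bar>f p\<bar>"]) (auto intro!: continuous_intros)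

lemma tame_bounded: "f \<in> borel_measurable borel \<Longrightarrow> (\<And>p. \<bar>f p\<bar> \<le> B) \<Longrightarrow> tame f"
  unfolding tame_def by (auto intro!: exI[of _ "\<lambda>_. B"] continuous_intros)

lemma tame_add: "tame f \<Longrightarrow> tame g \<Longrightarrow> tame (\<lambda>p. f p + g p)"
  unfolding tame_def
proof (elim conjE exE, intro conjI)
  fix C D
  assume *: "continuous_on UNIV C" "\<forall>p. \<bar>f p\<bar> \<le> C p" "continuous_on UNIV D" "\<forall>p. \<bar>g p\<bar> \<le> D p"
  show "\<exists>C. continuous_on UNIV C \<and> (\<forall>p. \<bar>f p + g p\<bar> \<le> C p)"
    using * by (intro exI[of _ "\<lambda>p. C p + D p"])
      (auto intro!: continuous_intros order_trans[OF abs_triangle_ineq] add_mono)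
qed auto

lemma tame_mult: "tame f \<Longrightarrow> tame g \<Longrightarrow> tame (\<lambda>p. f p * g p)"
  unfolding tame_def
proof (elim conjE exE, intro conjI)
  fix C D
  assume *: "continuous_on UNIV C" "\<forall>p. \<bar>f p\<bar> \<le> C p" "continuous_on UNIV D" "\<forall>p. \<bar>g p\<bar> \<le> D p"
  then have "0 \<le> C p" for p using abs_ge_zero order_trans by blast
  then show "\<exists>C. continuous_on UNIV C \<and> (\<forall>p. \<bar>f p * g p\<bar> \<le> C p)"
    using * by (intro exI[of _ "\<lambda>p. C p * D p"])
      (auto intro!: continuous_intros mult_mono simp: abs_mult)
qed auto

lemma tame_const: "tame (\<lambda>_. c)"
  by (rule tame_bounded) auto

lemma tame_diff: "tame f \<Longrightarrow> tame g \<Longrightarrow> tame (\<lambda>p. f p - g p)"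
  using tame_add[of f "\<lambda>p. (- 1) * g p"] tame_mult[OF tame_const[of "-1"], of g] by simp

lemma tame_bounded_on_compact:
  assumes "tame f" "compact K"
  obtains B where "\<And>p. p \<in> K \<Longrightarrow> \<bar>f p\<bar> \<le> B"
proof -
  obtain C where C: "continuous_on UNIV C" "\<And>p. \<bar>f p\<bar> \<le> C p"
    using assms(1) by (auto simp: tame_def)
  have "bounded (C ` K)"
    using C(1) assms(2) by (intro compact_imp_bounded compact_continuous_image) (auto intro: continuous_on_subset)
  then obtain B where B: "\<And>p. p \<in> K \<Longrightarrow> norm (C p) \<le> B"
    by (auto simp: bounded_iff)
  have "\<bar>f p\<bar> \<le> B" if "p \<in> K" for p
    using C(2)[of p] B[OF that] by simp
  then show thesis by (rule that)
qed

lemma tame_loc_bounded: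
  assumes "tame f"
  shows "loc_bounded f"
  unfolding loc_bounded_def
proof (intro allI impI)
  fix K assume "compact K \<and> K \<subseteq> half_plane"
  then obtain B where "\<And>p. p \<in> K \<Longrightarrow> \<bar>f p\<bar> \<le> B"
    using tame_bounded_on_compact[OF assms] by blast
  then show "bounded (f ` K)"
    unfolding bounded_iff by (intro exI[of _ B] ballI) (elim imageE, simp)
qed

lemma tame_loc_integrable:
  assumes "tame f"
  shows "loc_integrable f"
  unfolding loc_integrable_def
proof (intro allI impI)
  fix K assume "compact K \<and> K \<subseteq> half_plane"
  then have K: "compact K" by simp
  obtain B where B: "\<And>p. p \<in> K \<Longrightarrow> \<bar>f p\<bar> \<le> B"
    using tame_bounded_on_compact[OF assms K] by blast
  show "set_integrable lborel K f"
    unfolding set_integrable_def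
  proof (rule integrableI_bounded_set[where A=K and B=B])
    show "emeasure lborel K < \<infinity>"
      using K by (rule emeasure_compact_finite)
    show "(\<lambda>p. indicat_real K p *\<^sub>R f p) \<in> borel_measurable lborel"
      using assms borel_compact[OF K] by (auto simp: tame_def)
    show "K \<in> sets lborel" using borel_compact[OF K] by simp
  qed (use B in auto)
qed

text \<open>
  The shape of a tame function times a test function. Such functions are absolutely integrable over the
  plane and over every horizontal and vertical line, which is what iterated integrals need.
\<close>
definition box_bounded :: "(real \<times> real \<Rightarrow> real) \<Rightarrow> bool" where
  "box_bounded F \<longleftrightarrow> F \<in> borel_measurable borel \<and>
     (\<exists>B R. \<forall>x t. F (x, t) \<noteq> 0 \<longrightarrow> \<bar>F (x, t)\<bar> \<le> B \<and> \<bar>x\<bar> \<le> R \<and> 0 < t \<and> t \<le> R)"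

lemma box_bounded_tame_mult:
  assumes "tame f" "test_like \<psi>"
  shows "box_bounded (\<lambda>p. f p * \<psi> p)"
proof -
  obtain R where R: "\<And>x t. \<psi> (x, t) \<noteq> 0 \<Longrightarrow> \<bar>x\<bar> \<le> R \<and> 0 < t \<and> t \<le> R"
    using assms(2) by (auto simp: test_like_def)
  have t: "tame (\<lambda>p. f p * \<psi> p)"
    using assms(2) by (intro tame_mult[OF assms(1)] tame_continuous) (auto simp: test_like_def)
  obtain B where B: "\<And>p. p \<in> cbox (- R, 0) (R, R) \<Longrightarrow> \<bar>f p * \<psi> p\<bar> \<le> B"
    using tame_bounded_on_compact[OF t compact_cbox] by blast
  have "\<bar>f (x, t) * \<psi> (x, t)\<bar> \<le> B \<and> \<bar>x\<bar> \<le> R \<and> 0 < t \<and> t \<le> R"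
    if "f (x, t) * \<psi> (x, t) \<noteq> 0" for x t
    using R[of x t] B[of "(x, t)"] that by (simp add: cbox_Pair_eq abs_le_iff)
  with t show ?thesis
    unfolding box_bounded_def tame_def by blast
qed

lemma box_bounded_add:
  assumes "box_bounded F" "box_bounded G"
  shows "box_bounded (\<lambda>p. F p + G p)"
proof -
  obtain B R where
    F: "\<And>x t. F (x, t) \<noteq> 0 \<Longrightarrow> \<bar>F (x, t)\<bar> \<le> B \<and> \<bar>x\<bar> \<le> R \<and> 0 < t \<and> t \<le> R"
    using assms(1) unfolding box_bounded_def by blast
  obtain C S where
    G: "\<And>x t. G (x, t) \<noteq> 0 \<Longrightarrow> \<bar>G (x, t)\<bar> \<le> C \<and> \<bar>x\<bar> \<le> S \<and> 0 < t \<and> t \<le> S"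
    using assms(2) unfolding box_bounded_def by blast
  have "\<bar>F (x, t) + G (x, t)\<bar> \<le> \<bar>B\<bar> + \<bar>C\<bar> \<and> \<bar>x\<bar> \<le> max R S \<and> 0 < t \<and> t \<le> max R S"
    if "F (x, t) + G (x, t) \<noteq> 0" for x t
    using that F[of x t] G[of x t] by (cases "F (x, t) = 0"; cases "G (x, t) = 0") auto
  moreover have "(\<lambda>p. F p + G p) \<in> borel_measurable borel"
    using assms by (auto simp: box_bounded_def)
  ultimately show ?thesis
    unfolding box_bounded_def by blast
qed

lemma box_bounded_cmult: "box_bounded F \<Longrightarrow> box_bounded (\<lambda>p. c * F p)"
  unfolding box_bounded_def
proof (elim conjE exE, intro conjI)
  fix B R assume "\<forall>x t. F (x, t) \<noteq> 0 \<longrightarrow> \<bar>F (x, t)\<bar> \<le> B \<and> \<bar>x\<bar> \<le> R \<and> 0 < t \<and> t \<le> R"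
  then show "\<exists>B R. \<forall>x t. c * F (x, t) \<noteq> 0 \<longrightarrow> \<bar>c * F (x, t)\<bar> \<le> B \<and> \<bar>x\<bar> \<le> R \<and> 0 < t \<and> t \<le> R"
    by (intro exI[of _ "\<bar>c\<bar> * B"] exI[of _ R]) (auto simp: abs_mult intro!: mult_left_mono)
qed auto

lemma measurable_slices:
  fixes F :: "real \<times> real \<Rightarrow> real"
  assumes "F \<in> borel_measurable borel"
  shows "(\<lambda>x. F (x, t)) \<in> borel_measurable borel" "(\<lambda>t. F (x, t)) \<in> borel_measurable borel"
  by (rule measurable_compose[OF borel_measurable_continuous_onI assms], intro continuous_intros)+

lemma continuous_on_slices:
  fixes F :: "real \<times> real \<Rightarrow> real"
  assumes "continuous_on UNIV F"
  shows "continuous_on S (\<lambda>x. F (x, t))" "continuous_on S (\<lambda>t. F (x, t))"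
  by (rule continuous_on_compose2[OF assms], intro continuous_intros, simp)+

lemma box_bounded_integrable:
  assumes "box_bounded F"
  shows "integrable lborel F"
    and "integrable lborel (\<lambda>x. F (x, t))" and "integrable lborel (\<lambda>t. F (x, t))"
proof -
  from assms obtain B R where
    *: "\<And>x t. F (x, t) \<noteq> 0 \<Longrightarrow> \<bar>F (x, t)\<bar> \<le> B \<and> \<bar>x\<bar> \<le> R \<and> 0 < t \<and> t \<le> R"
    and meas: "F \<in> borel_measurable borel"
    unfolding box_bounded_def by blast
  have B: "\<bar>F p\<bar> \<le> \<bar>B\<bar>" for p
    using *[of "fst p" "snd p"] by (cases "F p = 0") auto
  show "integrable lborel F"
  proof (rule integrableI_bounded_set[where A="cbox (- R, 0) (R, R)" and B="\<bar>B\<bar>"])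
    show "AE p in lborel. p \<notin> cbox (- R, 0) (R, R) \<longrightarrow> F p = 0"
      using * by (intro AE_I2) (fastforce simp: cbox_Pair_eq)
    show "emeasure lborel (cbox (- R, 0) (R, R)) < \<infinity>"
      by (rule emeasure_lborel_cbox_finite)
  qed (use meas B in auto)
  show "integrable lborel (\<lambda>x. F (x, t))"
  proof (rule integrableI_bounded_set[where A="cbox (- R) R" and B="\<bar>B\<bar>"])
    show "AE p in lborel. p \<notin> cbox (- R) R \<longrightarrow> F (p, t) = 0"
      using * by (intro AE_I2) fastforce
    show "emeasure lborel (cbox (- R) R) < \<infinity>"
      by (rule emeasure_lborel_cbox_finite)
  qed (use measurable_slices[OF meas] B in auto)
  show "integrable lborel (\<lambda>t. F (x, t))"
  proof (rule integrableI_bounded_set[where A="cbox 0 R" and B="\<bar>B\<bar>"])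
    show "AE p in lborel. p \<notin> cbox 0 R \<longrightarrow> F (x, p) = 0"
      using * by (intro AE_I2) fastforce
    show "emeasure lborel (cbox 0 R) < \<infinity>"
      by (rule emeasure_lborel_cbox_finite)
  qed (use measurable_slices[OF meas] B in auto)
qed

lemma lborel_plane_Fubini:
  fixes F :: "real \<times> real \<Rightarrow> real"
  assumes "integrable lborel F"
  shows "(LINT p|lborel. F p) = (LINT t|lborel. LINT x|lborel. F (x, t))"
    and "(LINT p|lborel. F p) = (LINT x|lborel. LINT t|lborel. F (x, t))"
proof -
  have int: "integrable (lborel \<Otimes>\<^sub>M lborel) (\<lambda>(x, t). F (x, t))"
    using assms by (simp add: lborel_prod)
  show "(LINT p|lborel. F p) = (LINT t|lborel. LINT x|lborel. F (x, t))"
    using lborel_pair.integral_snd[where f="\<lambda>x t. F (x, t)"] int by (simp add: lborel_prod)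
  show "(LINT p|lborel. F p) = (LINT x|lborel. LINT t|lborel. F (x, t))"
    using lborel_pair.integral_fst[where f="\<lambda>x t. F (x, t)"] int by (simp add: lborel_prod)
qed

text \<open>
  The finite set \<open>S\<close> admits the points where the primitive has a kink and \<open>f'\<close> an arbitrary value.
\<close>
lemma integral_of_derivative:
  fixes f f' :: "real \<Rightarrow> real"
  assumes "a \<le> b" "finite S" "continuous_on {a..b} f"
    and "\<And>x. x \<in> {a<..<b} - S \<Longrightarrow> (f has_real_derivative f' x) (at x)"
    and "\<And>x. x \<notin> {a..b} \<Longrightarrow> f' x = 0" and "integrable lborel f'"
  shows "(LINT x|lborel. f' x) = f b - f a"
proof -
  have "(f' has_integral f b - f a) {a..b}"
    using assms(1-4)
    by (intro fundamental_theorem_of_calculus_interior_strong)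
       (auto simp: has_real_derivative_iff_has_vector_derivative)
  then have "(f' has_integral f b - f a) UNIV"
    by (rule has_integral_on_superset) (use assms(5) in auto)
  then show ?thesis
    using has_integral_integral_lborel[OF assms(6)] has_integral_unique by blast
qed

lemma fun_pairing_eq:
  assumes "\<And>x t. \<psi> (x, t) \<noteq> 0 \<Longrightarrow> t > 0"
  shows "fun_pairing f \<psi> = (LINT p|lborel. f p * \<psi> p)"
  unfolding fun_pairing_def set_lebesgue_integral_def
  using assms by (intro Bochner_Integration.integral_cong) (force simp: half_plane_def indicator_def)+

lemma test_function_support:
  assumes "test_function \<phi>"
  obtains R where "\<And>x t. \<phi> (x, t) \<noteq> 0 \<or> pd_x \<phi> (x, t) \<noteq> 0 \<or> pd_t \<phi> (x, t) \<noteq> 0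
    \<Longrightarrow> \<bar>x\<bar> \<le> R \<and> 0 < t \<and> t \<le> R"
proof -
  note tl = test_function_test_like[OF assms]
  obtain R0 where 0: "\<And>x t. \<phi> (x, t) \<noteq> 0 \<Longrightarrow> \<bar>x\<bar> \<le> R0 \<and> 0 < t \<and> t \<le> R0"
    using tl(1) unfolding test_like_def by blast
  obtain R1 where 1: "\<And>x t. pd_x \<phi> (x, t) \<noteq> 0 \<Longrightarrow> \<bar>x\<bar> \<le> R1 \<and> 0 < t \<and> t \<le> R1"
    using tl(2) unfolding test_like_def by blast
  obtain R2 where 2: "\<And>x t. pd_t \<phi> (x, t) \<noteq> 0 \<Longrightarrow> \<bar>x\<bar> \<le> R2 \<and> 0 < t \<and> t \<le> R2"
    using tl(3) unfolding test_like_def by blast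
  have "\<bar>x\<bar> \<le> max R0 (max R1 R2) \<and> 0 < t \<and> t \<le> max R0 (max R1 R2)"
    if "\<phi> (x, t) \<noteq> 0 \<or> pd_x \<phi> (x, t) \<noteq> 0 \<or> pd_t \<phi> (x, t) \<noteq> 0" for x t
    using that 0[of x t] 1[of x t] 2[of x t] by auto
  then show thesis by (rule that)
qed

text \<open>
  Integration by parts on each horizontal line. Since \<open>f\<close> is continuous across the curve \<open>x = c t\<close>, the
  missing derivative there contributes nothing.
\<close>
lemma weak_pd_x_of_piecewise_derivative:
  assumes "continuous_on UNIV f" "tame f'"
    and deriv: "\<And>x t. x \<noteq> c t \<Longrightarrow> ((\<lambda>x. f (x, t)) has_real_derivative f' (x, t)) (at x)"
  shows "weak_pd_x f f'"
  unfolding weak_pd_x_def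
proof (intro conjI allI impI)
  have f: "tame f" using assms(1) by (rule tame_continuous)
  show "loc_integrable f" "loc_integrable f'"
    using f assms(2) by (auto intro: tame_loc_integrable)
  fix \<psi> assume \<psi>: "test_function \<psi>"
  note tl = test_function_test_like[OF \<psi>]
  note bb = box_bounded_tame_mult[OF assms(2) tl(1)] box_bounded_tame_mult[OF f tl(2)]
  obtain R where R: "\<And>x t. \<psi> (x, t) \<noteq> 0 \<or> pd_x \<psi> (x, t) \<noteq> 0 \<or> pd_t \<psi> (x, t) \<noteq> 0
      \<Longrightarrow> \<bar>x\<bar> \<le> R \<and> 0 < t \<and> t \<le> R"
    using test_function_support[OF \<psi>] by blast
  have slice: "(LINT x|lborel. f' (x, t) * \<psi> (x, t) + f (x, t) * pd_x \<psi> (x, t)) = 0" for t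
  proof -
    have "(LINT x|lborel. f' (x, t) * \<psi> (x, t) + f (x, t) * pd_x \<psi> (x, t))
        = f (\<bar>R\<bar> + 1, t) * \<psi> (\<bar>R\<bar> + 1, t) - f (- (\<bar>R\<bar> + 1), t) * \<psi> (- (\<bar>R\<bar> + 1), t)"
    proof (rule integral_of_derivative[where S="{c t}" and f="\<lambda>x. f (x, t) * \<psi> (x, t)"
          and a="- (\<bar>R\<bar> + 1)" and b="\<bar>R\<bar> + 1"])
      show "continuous_on {- (\<bar>R\<bar> + 1)..\<bar>R\<bar> + 1} (\<lambda>x. f (x, t) * \<psi> (x, t))"
        using tl(1) assms(1) by (auto simp: test_like_def intro!: continuous_on_mult continuous_on_slices)
      show "integrable lborel (\<lambda>x. f' (x, t) * \<psi> (x, t) + f (x, t) * pd_x \<psi> (x, t))"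
        using bb by (intro Bochner_Integration.integrable_add box_bounded_integrable(2))
      show "f' (x, t) * \<psi> (x, t) + f (x, t) * pd_x \<psi> (x, t) = 0"
        if "x \<notin> {- (\<bar>R\<bar> + 1)..\<bar>R\<bar> + 1}" for x
        using R[of x t] that by (cases "\<psi> (x, t) = 0 \<and> pd_x \<psi> (x, t) = 0") auto
      show "((\<lambda>x. f (x, t) * \<psi> (x, t)) has_real_derivative
          f' (x, t) * \<psi> (x, t) + f (x, t) * pd_x \<psi> (x, t)) (at x)"
        if "x \<in> {- (\<bar>R\<bar> + 1)<..<\<bar>R\<bar> + 1} - {c t}" for x
      proof -
        have "((\<lambda>x. \<psi> (x, t)) has_real_derivative pd_x \<psi> (x, t)) (at x)"
          using has_derivative_along_line[of \<psi> 0 1 x t 0] test_function_differentiable[OF \<psi>] by simp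
        from DERIV_mult[OF deriv[of x t] this] that show ?thesis
          by (simp add: algebra_simps)
      qed
    qed auto
    also have "\<dots> = 0"
    proof -
      have "\<psi> (\<bar>R\<bar> + 1, t) = 0" "\<psi> (- (\<bar>R\<bar> + 1), t) = 0"
        using R[of "\<bar>R\<bar> + 1" t] R[of "- (\<bar>R\<bar> + 1)" t] by linarith+
      then show ?thesis by simp
    qed
    finally show ?thesis .
  qed
  have "fun_pairing f' \<psi> + fun_pairing f (pd_x \<psi>)
      = (LINT p|lborel. f' p * \<psi> p + f p * pd_x \<psi> p)"
  proof -
    have "fun_pairing f' \<psi> = (LINT p|lborel. f' p * \<psi> p)"
      using R by (intro fun_pairing_eq) blast
    moreover have "fun_pairing f (pd_x \<psi>) = (LINT p|lborel. f p * pd_x \<psi> p)"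
      using R by (intro fun_pairing_eq) blast
    ultimately show ?thesis
      by (simp add: Bochner_Integration.integral_add[OF bb[THEN box_bounded_integrable(1)]])
  qed
  also have "\<dots> = 0"
    unfolding lborel_plane_Fubini(1)[OF box_bounded_integrable(1)[OF box_bounded_add[OF bb]]] slice
    by simp
  finally show "fun_pairing f' \<psi> = - fun_pairing f (pd_x \<psi>)" by simp
qed

section \<open>Filtering the density as a distribution\<close>

text \<open>
  The bound says that \<open>K\<close> is absolutely integrable over the product of the line and the plane.
\<close>
lemma integral_kernel_exchange:
  fixes K :: "real \<times> (real \<times> real) \<Rightarrow> real"
  assumes meas: "K \<in> borel_measurable (borel \<Otimes>\<^sub>M borel)"
    and g: "integrable lborel g"
    and int: "\<And>z. integrable lborel (\<lambda>p. K (z, p))"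
    and bound: "\<And>z. (LINT p|lborel. \<bar>K (z, p)\<bar>) \<le> N * \<bar>g z\<bar>"
  shows "(LINT p|lborel. LINT z|lborel. K (z, p)) = (LINT z|lborel. LINT p|lborel. K (z, p))"
proof -
  have meas' [measurable]: "K \<in> borel_measurable (lborel \<Otimes>\<^sub>M lborel)"
    using meas by (simp cong: measurable_cong_sets sets_pair_measure_cong)
  have "integrable (lborel \<Otimes>\<^sub>M lborel) K"
  proof (rule lborel_pair.Fubini_integrable)
    show "integrable lborel (\<lambda>z. LINT p|lborel. norm (K (z, p)))"
    proof (rule Bochner_Integration.integrable_bound)
      show "integrable lborel (\<lambda>z. N * \<bar>g z\<bar>)"
        using g by simp
      show "AE z in lborel. norm (LINT p|lborel. norm (K (z, p))) \<le> norm (N * \<bar>g z\<bar>)"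
      proof (rule AE_I2)
        fix z
        have "0 \<le> (LINT p|lborel. \<bar>K (z, p)\<bar>)" by simp
        with bound[of z] show "norm (LINT p|lborel. norm (K (z, p))) \<le> norm (N * \<bar>g z\<bar>)"
          by simp
      qed
    qed measurable
  qed (use int in auto)
  then have *: "integrable (lborel \<Otimes>\<^sub>M lborel) (\<lambda>(z, p). K (z, p))" by simp
  show ?thesis
    using lborel_pair.integral_fst[where f="\<lambda>z p. K (z, p)", OF *] lborel_pair.integral_snd[where f="\<lambda>z p. K (z, p)", OF *]
    by simp
qed

lemma lborel_integral_translate:
  fixes f :: "'a::euclidean_space \<Rightarrow> real"
  assumes [measurable]: "f \<in> borel_measurable borel"
  shows "(LINT p|lborel. f (c + p)) = (LINT p|lborel. f p)"
proof -
  have "(LINT p|lborel. f p) = (LINT p|distr lborel borel ((+) c). f p)"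
    by (simp add: lborel_distr_plus)
  also have "\<dots> = (LINT p|lborel. f (c + p))"
    by (rule integral_distr) auto
  finally show ?thesis by simp
qed

lemma lborel_integrable_translate:
  fixes f :: "'a::euclidean_space \<Rightarrow> real"
  assumes "integrable lborel f"
  shows "integrable lborel (\<lambda>p. f (c + p))"
  by (rule integrable_distr[of "(+) c" lborel lborel f])
     (use assms in \<open>auto simp: lborel_distr_plus[of c, unfolded distr_cong[OF refl sets_lborel[symmetric] refl]]\<close>)

text \<open>
  Both sides are double integrals of \<open>g z * h * \<psi>\<close> with one factor shifted by \<open>(z, 0)\<close>; for fixed \<open>z\<close>
  they agree because Lebesgue measure on the plane is invariant under this shift.
\<close>
lemma conv_x_adjoint:
  fixes h \<psi> :: "real \<times> real \<Rightarrow> real"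
  assumes g: "integrable lborel g"
    and [measurable]: "h \<in> borel_measurable borel" and M: "\<And>p. \<bar>h p\<bar> \<le> M"
    and \<psi>: "integrable lborel \<psi>"
  shows "(LINT p|lborel. h p * conv_x (\<lambda>z. g (- z)) \<psi> p) = (LINT p|lborel. conv_x g h p * \<psi> p)"
proof -
  define N where "N = M * (LINT p|lborel. \<bar>\<psi> p\<bar>)"
  have [measurable]: "g \<in> borel_measurable borel" "\<psi> \<in> borel_measurable borel"
    using g \<psi> by auto
  have M0: "M \<ge> 0" using M[of 0] by simp
  have shifted_\<psi>: "integrable lborel (\<lambda>p. \<psi> ((z, 0) + p))" for z
    by (rule lborel_integrable_translate[OF \<psi>])
  \<comment> \<open>\<open>F (z, _)\<close> and \<open>G (z, _)\<close> are translates of each other by \<open>(z, 0)\<close>.\<close>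
  define F where "F = (\<lambda>(z, p). g z * (h p * \<psi> ((z, 0) + p)))"
  define G where "G = (\<lambda>(z, p). g z * (h (p - (z, 0)) * \<psi> p))"
  have meas: "F \<in> borel_measurable (borel \<Otimes>\<^sub>M borel)" "G \<in> borel_measurable (borel \<Otimes>\<^sub>M borel)"
    unfolding F_def G_def by measurable
  have int: "integrable lborel (\<lambda>p. h' p * \<psi>' p)" "(LINT p|lborel. \<bar>h' p * \<psi>' p\<bar>) \<le> M * (LINT p|lborel. \<bar>\<psi>' p\<bar>)"
    if [measurable]: "h' \<in> borel_measurable borel" and "\<And>p. \<bar>h' p\<bar> \<le> M" "integrable lborel \<psi>'"
    for h' \<psi>' :: "real \<times> real \<Rightarrow> real"
  proof -
    have M\<psi>: "integrable lborel (\<lambda>p. M * \<bar>\<psi>' p\<bar>)" using that(3) by simp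
    have le: "\<bar>h' p * \<psi>' p\<bar> \<le> M * \<bar>\<psi>' p\<bar>" for p
      using that(2)[of p] by (simp add: abs_mult mult_right_mono)
    show i: "integrable lborel (\<lambda>p. h' p * \<psi>' p)"
      using that(3) le M0 by (intro Bochner_Integration.integrable_bound[OF M\<psi>]) auto
    have "(LINT p|lborel. \<bar>h' p * \<psi>' p\<bar>) \<le> (LINT p|lborel. M * \<bar>\<psi>' p\<bar>)"
      by (rule integral_mono) (use i M\<psi> le in auto)
    then show "(LINT p|lborel. \<bar>h' p * \<psi>' p\<bar>) \<le> M * (LINT p|lborel. \<bar>\<psi>' p\<bar>)" by simp
  qed
  have F: "integrable lborel (\<lambda>p. F (z, p))" "(LINT p|lborel. \<bar>F (z, p)\<bar>) \<le> N * \<bar>g z\<bar>" for z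
  proof -
    have "(LINT p|lborel. \<bar>\<psi> ((z, 0) + p)\<bar>) = (LINT p|lborel. \<bar>\<psi> p\<bar>)"
      by (rule lborel_integral_translate) measurable
    with int[of h, OF _ M shifted_\<psi>[of z]]
    have i: "integrable lborel (\<lambda>p. h p * \<psi> ((z, 0) + p))"
      and b: "(LINT p|lborel. \<bar>h p * \<psi> ((z, 0) + p)\<bar>) \<le> N"
      by (auto simp: N_def)
    from i show "integrable lborel (\<lambda>p. F (z, p))" by (simp add: F_def)
    show "(LINT p|lborel. \<bar>F (z, p)\<bar>) \<le> N * \<bar>g z\<bar>"
      using mult_left_mono[OF b, of "\<bar>g z\<bar>"] by (simp add: F_def abs_mult[of "g z"] mult.commute)
  qed
  have G: "integrable lborel (\<lambda>p. G (z, p))" "(LINT p|lborel. \<bar>G (z, p)\<bar>) \<le> N * \<bar>g z\<bar>" for z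
  proof -
    from int[of "\<lambda>p. h (p - (z, 0))", OF _ M \<psi>]
    have i: "integrable lborel (\<lambda>p. h (p - (z, 0)) * \<psi> p)"
      and b: "(LINT p|lborel. \<bar>h (p - (z, 0)) * \<psi> p\<bar>) \<le> N"
      by (auto simp: N_def)
    from i show "integrable lborel (\<lambda>p. G (z, p))" by (simp add: G_def)
    show "(LINT p|lborel. \<bar>G (z, p)\<bar>) \<le> N * \<bar>g z\<bar>"
      using mult_left_mono[OF b, of "\<bar>g z\<bar>"] by (simp add: G_def abs_mult[of "g z"] mult.commute)
  qed
  have reflected: "h p * conv_x (\<lambda>z. g (- z)) \<psi> p = (LINT z|lborel. F (z, p))" for p
  proof -
    obtain x t where p: "p = (x, t)" by (cases p)
    have "conv_x (\<lambda>z. g (- z)) \<psi> (x, t) = (LINT z|lborel. g z * \<psi> (x + z, t))"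
      unfolding conv_x_eq_shifted
      using lborel_integral_real_affine[of "-1" "\<lambda>z. g z * \<psi> (x + z, t)" 0] by simp
    also have "h (x, t) * \<dots> = (LINT z|lborel. h (x, t) * (g z * \<psi> (x + z, t)))"
      by simp
    finally show ?thesis
      by (simp add: p F_def mult_ac add.commute)
  qed
  have direct: "conv_x g h p * \<psi> p = (LINT z|lborel. G (z, p))" for p
  proof -
    obtain x t where p: "p = (x, t)" by (cases p)
    have "conv_x g h (x, t) * \<psi> (x, t) = (LINT z|lborel. g z * h (x - z, t) * \<psi> (x, t))"
      unfolding conv_x_eq_shifted by simp
    then show ?thesis
      by (simp add: p G_def mult_ac)
  qed
  have swap: "(LINT p|lborel. F (z, p)) = (LINT p|lborel. G (z, p))" for z
  proof -
    have "(LINT p|lborel. G (z, (z, 0) + p)) = (LINT p|lborel. G (z, p))"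
      by (rule lborel_integral_translate) (simp add: G_def)
    then show ?thesis
      by (simp add: F_def G_def)
  qed
  have "(LINT p|lborel. LINT z|lborel. F (z, p)) = (LINT z|lborel. LINT p|lborel. F (z, p))"
    by (rule integral_kernel_exchange[OF meas(1) g F])
  also have "\<dots> = (LINT z|lborel. LINT p|lborel. G (z, p))"
    by (simp add: swap)
  also have "\<dots> = (LINT p|lborel. LINT z|lborel. G (z, p))"
    by (rule integral_kernel_exchange[OF meas(2) g G, symmetric])
  finally show ?thesis
    by (simp add: reflected direct)
qed

text \<open>
  The factor \<open>sqrt (1 + \<sigma>\<^sup>2)\<close> is the speed of the parametrization \<open>(\<sigma> s, s)\<close>.
\<close>
lemma weighted_delta_line:
  assumes "\<And>x t. \<Psi> (x, t) \<noteq> 0 \<Longrightarrow> t > 0"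
  shows "weighted_delta w (\<lambda>s. \<sigma> * s) (\<lambda>s. s) {0..} \<Psi>
    = (LINT s|lborel. w s * sqrt (1 + \<sigma>\<^sup>2) * \<Psi> (\<sigma> * s, s))"
  unfolding weighted_delta_def set_lebesgue_integral_def
proof (rule Bochner_Integration.integral_cong[OF refl])
  fix s
  have "deriv (\<lambda>s. \<sigma> * s) s = \<sigma>" "deriv (\<lambda>s. s) s = 1"
    by (auto intro!: DERIV_imp_deriv derivative_eq_intros)
  then show "indicat_real {0..} s *\<^sub>R (w s * \<Psi> (\<sigma> * s, s) *
      sqrt ((deriv (\<lambda>s. \<sigma> * s) s)\<^sup>2 + (deriv (\<lambda>s. s) s)\<^sup>2))
    = w s * sqrt (1 + \<sigma>\<^sup>2) * \<Psi> (\<sigma> * s, s)"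
    using assms[of "\<sigma> * s" s] by (auto simp: indicator_def add.commute mult_ac)
qed

text \<open>
  The regular part moves over by \<open>conv_x_adjoint\<close>. For the singular part, the
  integral of the filtered test function along the line is already an iterated integral of the test
  function over the plane, with density \<open>w t * sqrt (1 + \<sigma>\<^sup>2) * g (x - \<sigma> t)\<close>.
\<close>
lemma represents_conv_x_rho:
  assumes g: "integrable lborel g"
    and h: "h \<in> borel_measurable borel" "\<And>p. \<bar>h p\<bar> \<le> M"
    and tame_h: "tame (conv_x g h)"
    and tame_\<delta>: "tame (\<lambda>(x, t). w t * sqrt (1 + \<sigma>\<^sup>2) * g (x - \<sigma> * t))"
  shows "represents_conv_x g (rho_pairing h w (\<lambda>s. \<sigma> * s) (\<lambda>s. s) {0..})
    (\<lambda>(x, t). conv_x g h (x, t) + w t * sqrt (1 + \<sigma>\<^sup>2) * g (x - \<sigma> * t))"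
  unfolding represents_conv_x_def
proof (intro conjI allI impI)
  let ?k = "\<lambda>(x, t). w t * sqrt (1 + \<sigma>\<^sup>2) * g (x - \<sigma> * t)"
  let ?R = "\<lambda>(x, t). conv_x g h (x, t) + w t * sqrt (1 + \<sigma>\<^sup>2) * g (x - \<sigma> * t)"
  have R: "?R = (\<lambda>p. conv_x g h p + ?k p)" by (simp add: fun_eq_iff)
  show "loc_integrable ?R"
    unfolding R by (intro tame_loc_integrable tame_add tame_h tame_\<delta>)
  fix \<psi> assume "test_function \<psi>"
  note \<psi> = test_function_test_like(1)[OF this]
  let ?c = "conv_x (\<lambda>z. g (- z)) \<psi>"
  have pos: "\<psi> (x, t) \<noteq> 0 \<Longrightarrow> t > 0" for x t
    using \<psi> by (auto simp: test_like_def)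
  have "?c (x, t) = 0" if "\<not> t > 0" for x t
  proof -
    have "\<psi> (y, t) = 0" for y using pos[of y t] that by blast
    then show ?thesis by (simp add: conv_x_def)
  qed
  then have pos_c: "?c (x, t) \<noteq> 0 \<Longrightarrow> t > 0" for x t by blast
  note bb = box_bounded_tame_mult[OF tame_h \<psi>] box_bounded_tame_mult[OF tame_\<delta> \<psi>]
  have int_\<psi>: "integrable lborel \<psi>"
    using box_bounded_integrable(1)[OF box_bounded_tame_mult[OF tame_const[of 1] \<psi>]] by simp
  have "fun_pairing ?R \<psi> = (LINT p|lborel. conv_x g h p * \<psi> p + ?k p * \<psi> p)"
    unfolding R using pos by (subst fun_pairing_eq) (auto simp: distrib_right)
  also have "\<dots> = (LINT p|lborel. conv_x g h p * \<psi> p) + (LINT p|lborel. ?k p * \<psi> p)"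
    by (rule Bochner_Integration.integral_add[OF bb[THEN box_bounded_integrable(1)]])
  also have "(LINT p|lborel. conv_x g h p * \<psi> p) = fun_pairing h ?c"
    using conv_x_adjoint[OF g h int_\<psi>] fun_pairing_eq[OF pos_c] by simp
  also have "(LINT p|lborel. ?k p * \<psi> p)
      = (LINT t|lborel. LINT x|lborel. w t * sqrt (1 + \<sigma>\<^sup>2) * (g (x - \<sigma> * t) * \<psi> (x, t)))"
    unfolding lborel_plane_Fubini(1)[OF box_bounded_integrable(1)[OF bb(2)]] by (simp add: mult.assoc)
  also have "\<dots> = weighted_delta w (\<lambda>s. \<sigma> * s) (\<lambda>s. s) {0..} ?c"
    using weighted_delta_line[of ?c w \<sigma>] pos_c by (simp add: conv_x_def)
  finally show "fun_pairing ?R \<psi> = rho_pairing h w (\<lambda>s. \<sigma> * s) (\<lambda>s. s) {0..} ?c"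
    by (simp add: rho_pairing_def)
qed

section \<open>Weak form of a step that carries a delta on its jump line\<close>

lemma test_like_shear:
  assumes "test_like \<psi>"
  shows "test_like (\<lambda>(z, t). \<psi> (z + \<sigma> * t, t))"
proof -
  obtain R where R: "\<And>x t. \<psi> (x, t) \<noteq> 0 \<Longrightarrow> \<bar>x\<bar> \<le> R \<and> 0 < t \<and> t \<le> R"
    and cont: "continuous_on UNIV \<psi>"
    using assms unfolding test_like_def by blast
  have "continuous_on UNIV (\<lambda>(z, t). \<psi> (z + \<sigma> * t, t))"
    unfolding split_def by (rule continuous_on_compose2[OF cont]) (auto intro!: continuous_intros)
  moreover have "\<bar>z\<bar> \<le> R + \<bar>\<sigma>\<bar> * R \<and> 0 < t \<and> t \<le> R + \<bar>\<sigma>\<bar> * R" if "\<psi> (z + \<sigma> * t, t) \<noteq> 0" for z t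
  proof -
    from R[OF that] have *: "\<bar>z + \<sigma> * t\<bar> \<le> R" "0 < t" "t \<le> R" by auto
    have "\<bar>\<sigma> * t\<bar> \<le> \<bar>\<sigma>\<bar> * R" "0 \<le> \<bar>\<sigma>\<bar> * R"
      using * by (auto simp: abs_mult intro!: mult_left_mono)
    with * show ?thesis by linarith
  qed
  ultimately show ?thesis
    unfolding test_like_def by auto
qed

lemma integrable_on_line:
  assumes "test_like \<psi>"
  shows "integrable lborel (\<lambda>s. s ^ k * \<psi> (\<sigma> * s, s))"
proof -
  have "tame (\<lambda>p. snd p ^ k)"
    by (intro tame_continuous continuous_intros)
  from box_bounded_integrable(3)[OF box_bounded_tame_mult[OF this test_like_shear[OF assms, of \<sigma>]], of 0]
  show ?thesis by simp
qed

text \<open>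
  The line meets every horizontal line in a single point, which is a null set there.
\<close>
lemma integral_eq_off_line:
  assumes F: "box_bounded F" and G: "box_bounded G"
    and eq: "\<And>x t. x \<noteq> \<sigma> * t \<Longrightarrow> F (x, t) = G (x, t)"
  shows "(LINT p|lborel. F p) = (LINT p|lborel. G p)"
proof -
  have "(LINT x|lborel. F (x, t)) = (LINT x|lborel. G (x, t))" for t
  proof (rule integral_cong_AE)
    show "AE x in lborel. F (x, t) = G (x, t)"
      using AE_lborel_singleton[of "\<sigma> * t"] by eventually_elim (rule eq)
  qed (use F G box_bounded_integrable(2) in auto)
  then show ?thesis
    by (simp add: lborel_plane_Fubini(1) box_bounded_integrable(1) F G)
qed

lemma tame_rho_regular: "tame (rho_regular A C \<sigma>)"
proof (rule tame_bounded)
  have "{p. fst p < \<sigma> * snd p} \<in> sets borel"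
    by (intro borel_open open_Collect_less continuous_intros)
  then have "(\<lambda>p. if p \<in> {p. fst p < \<sigma> * snd p} then A else C) \<in> borel_measurable borel"
    by (intro measurable_If_set) auto
  then show "rho_regular A C \<sigma> \<in> borel_measurable borel"
    by (simp add: rho_regular_def split_def)
  show "\<bar>rho_regular A C \<sigma> p\<bar> \<le> max \<bar>A\<bar> \<bar>C\<bar>" for p
    by (cases p) (auto simp: rho_regular_def)
qed

text \<open>
  The step is constant along the direction \<open>(\<sigma>, 1)\<close>, and \<open>\<phi>\<^sub>t + \<sigma> \<phi>\<^sub>x\<close> is the derivative of \<open>\<phi>\<close> in that
  direction. After shearing the line to the vertical axis, the \<open>t\<close>-integral of this derivative vanishes.
\<close>
lemma advected_step_is_conserved:
  assumes \<phi>: "test_function \<phi>"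
  shows "(LINT p|lborel. rho_regular A C \<sigma> p * (pd_t \<phi> p + \<sigma> * pd_x \<phi> p)) = 0"
proof -
  let ?D = "\<lambda>p. pd_t \<phi> p + \<sigma> * pd_x \<phi> p" and ?h = "rho_regular A C \<sigma>" and ?k = "rho_regular A C 0"
  \<comment> \<open>The sheared test function and its \<open>t\<close>-derivative; \<open>?k\<close> is the step in sheared coordinates.\<close>
  define S where "S = (\<lambda>(z, t). \<phi> (z + \<sigma> * t, t))"
  define DS where "DS = (\<lambda>(z, t). ?D (z + \<sigma> * t, t))"
  note tl = test_function_test_like[OF \<phi>]
  have tlS: "test_like S"
    unfolding S_def by (rule test_like_shear[OF tl(1)])
  have bb: "box_bounded (\<lambda>p. ?h p * ?D p)"
    using box_bounded_add[OF box_bounded_tame_mult[OF tame_rho_regular[of A C \<sigma>] tl(3)]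
        box_bounded_cmult[OF box_bounded_tame_mult[OF tame_rho_regular[of A C \<sigma>] tl(2)], of \<sigma>]]
    by (simp add: algebra_simps)
  have bbS: "box_bounded (\<lambda>p. ?k p * DS p)"
    using box_bounded_add[OF box_bounded_tame_mult[OF tame_rho_regular[of A C 0] test_like_shear[OF tl(3), of \<sigma>]]
        box_bounded_cmult[OF box_bounded_tame_mult[OF tame_rho_regular[of A C 0] test_like_shear[OF tl(2), of \<sigma>]], of \<sigma>]]
    by (simp add: DS_def split_def algebra_simps)
  obtain R where R: "\<And>x t. \<phi> (x, t) \<noteq> 0 \<or> pd_x \<phi> (x, t) \<noteq> 0 \<or> pd_t \<phi> (x, t) \<noteq> 0
      \<Longrightarrow> \<bar>x\<bar> \<le> R \<and> 0 < t \<and> t \<le> R"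
    using test_function_support[OF \<phi>] by blast
  have vanish: "(LINT t|lborel. ?k (z, t) * DS (z, t)) = 0" for z
  proof -
    have "(LINT t|lborel. ?k (z, 0) * DS (z, t)) = ?k (z, 0) * S (z, \<bar>R\<bar> + 1) - ?k (z, 0) * S (z, 0)"
    proof (rule integral_of_derivative[where S="{}" and f="\<lambda>t. ?k (z, 0) * S (z, t)"])
      show "continuous_on {0..\<bar>R\<bar> + 1} (\<lambda>t. ?k (z, 0) * S (z, t))"
        using tlS by (intro continuous_on_mult continuous_on_const continuous_on_slices) (auto simp: test_like_def)
      show "?k (z, 0) * DS (z, t) = 0" if "t \<notin> {0..\<bar>R\<bar> + 1}" for t
      proof -
        have "pd_x \<phi> (z + \<sigma> * t, t) = 0 \<and> pd_t \<phi> (z + \<sigma> * t, t) = 0"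
          using R[of "z + \<sigma> * t" t] that by fastforce
        then show ?thesis by (simp add: DS_def)
      qed
      show "integrable lborel (\<lambda>t. ?k (z, 0) * DS (z, t))"
        using box_bounded_integrable(3)[OF bbS, of z] by (simp add: rho_regular_def)
      show "((\<lambda>t. ?k (z, 0) * S (z, t)) has_real_derivative ?k (z, 0) * DS (z, t)) (at t)" for t
        using has_derivative_along_line[of \<phi> z \<sigma> t 0 1] test_function_differentiable[OF \<phi>]
        by (intro DERIV_cmult) (simp add: S_def DS_def add.commute)
    qed auto
    also have "\<dots> = 0"
    proof -
      have "\<phi> (z + \<sigma> * (\<bar>R\<bar> + 1), \<bar>R\<bar> + 1) = 0"
        using R[of "z + \<sigma> * (\<bar>R\<bar> + 1)" "\<bar>R\<bar> + 1"] by linarith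
      moreover have "\<phi> (z, 0) = 0"
        using R[of z 0] by blast
      ultimately show ?thesis by (simp add: S_def)
    qed
    finally show ?thesis by (simp add: rho_regular_def)
  qed
  have shear: "(LINT x|lborel. ?h (x, t) * ?D (x, t)) = (LINT z|lborel. ?k (z, t) * DS (z, t))" for t
    using lborel_integral_real_affine[of 1 "\<lambda>x. ?h (x, t) * ?D (x, t)" "\<sigma> * t"]
    by (simp add: DS_def rho_regular_def add.commute)
  have "(LINT p|lborel. ?h p * ?D p) = (LINT t|lborel. LINT z|lborel. ?k (z, t) * DS (z, t))"
    unfolding lborel_plane_Fubini(1)[OF box_bounded_integrable(1)[OF bb]] shear ..
  also have "\<dots> = (LINT z|lborel. LINT t|lborel. ?k (z, t) * DS (z, t))"
    using lborel_plane_Fubini[OF box_bounded_integrable(1)[OF bbS]] by simp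
  finally show ?thesis
    by (simp add: vanish)
qed

text \<open>
  On each horizontal line the integrand has a continuous primitive, a step times the difference of \<open>\<phi>\<close>
  and its value at the jump. Beyond the support of \<open>\<phi>\<close> only that value is left of it.
\<close>
lemma step_flux_concentrates_on_line:
  assumes \<phi>: "test_function \<phi>"
  shows "(LINT p|lborel. rho_regular A C \<sigma> p * pd_x \<phi> p) = (A - C) * (LINT t|lborel. \<phi> (\<sigma> * t, t))"
proof -
  let ?h = "rho_regular A C \<sigma>"
  note tl = test_function_test_like[OF \<phi>]
  note bb = box_bounded_tame_mult[OF tame_rho_regular[of A C \<sigma>] tl(2)]
  obtain R where R: "\<And>x t. \<phi> (x, t) \<noteq> 0 \<or> pd_x \<phi> (x, t) \<noteq> 0 \<or> pd_t \<phi> (x, t) \<noteq> 0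
      \<Longrightarrow> \<bar>x\<bar> \<le> R \<and> 0 < t \<and> t \<le> R"
    using test_function_support[OF \<phi>] by blast
  have slice: "(LINT x|lborel. ?h (x, t) * pd_x \<phi> (x, t)) = (A - C) * \<phi> (\<sigma> * t, t)" for t
  proof -
    define a where "a = \<sigma> * t"
    define b where "b = \<bar>R\<bar> + \<bar>a\<bar> + 1"
    \<comment> \<open>The primitive of the integrand that vanishes at the jump: \<open>A\<close> or \<open>C\<close> times \<open>\<phi> (x, t) - \<phi> (a, t)\<close>.
      The use of \<open>min\<close> makes its continuity evident.\<close>
    define F where "F x = C * (\<phi> (x, t) - \<phi> (a, t)) + (A - C) * (\<phi> (min x a, t) - \<phi> (a, t))" for x
    have \<phi>': "((\<lambda>x. \<phi> (x, t)) has_real_derivative pd_x \<phi> (x, t)) (at x)" for x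
      using has_derivative_along_line[of \<phi> 0 1 x t 0] test_function_differentiable[OF \<phi>] by simp
    have cont: "continuous_on UNIV (\<lambda>x. \<phi> (x, t))"
      using tl(1) by (auto simp: test_like_def intro: continuous_on_slices)
    have "(LINT x|lborel. ?h (x, t) * pd_x \<phi> (x, t)) = F b - F (- b)"
    proof (rule integral_of_derivative[where S="{a}" and f=F])
      show "continuous_on {- b..b} F"
        unfolding F_def
        by (intro continuous_intros continuous_on_compose2[OF cont]) auto
      show "integrable lborel (\<lambda>x. ?h (x, t) * pd_x \<phi> (x, t))"
        by (rule box_bounded_integrable(2)[OF bb])
      show "?h (x, t) * pd_x \<phi> (x, t) = 0" if "x \<notin> {- b..b}" for x
        using R[of x t] that by (cases "pd_x \<phi> (x, t) = 0") (auto simp: b_def)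
      show "(F has_real_derivative ?h (x, t) * pd_x \<phi> (x, t)) (at x)" if "x \<in> {- b<..<b} - {a}" for x
      proof (cases "x < a")
        case True
        have "((\<lambda>x. A * (\<phi> (x, t) - \<phi> (a, t))) has_real_derivative ?h (x, t) * pd_x \<phi> (x, t)) (at x)"
          using True by (auto intro!: derivative_eq_intros \<phi>' simp: rho_regular_def a_def)
        then show ?thesis
          by (rule has_field_derivative_transform_within_open[where S="{..<a}"])
             (use True in \<open>auto simp: F_def min_def algebra_simps\<close>)
      next
        case False
        have "((\<lambda>x. C * (\<phi> (x, t) - \<phi> (a, t))) has_real_derivative ?h (x, t) * pd_x \<phi> (x, t)) (at x)"
          using False by (auto intro!: derivative_eq_intros \<phi>' simp: rho_regular_def a_def)
        then show ?thesis
          by (rule has_field_derivative_transform_within_open[where S="{a<..}"])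
             (use False that in \<open>auto simp: F_def min_def algebra_simps\<close>)
      qed
    qed (auto simp: b_def)
    also have "\<dots> = (A - C) * \<phi> (a, t)"
    proof -
      have "\<phi> (b, t) = 0" "\<phi> (- b, t) = 0"
        using R[of b t] R[of "- b" t] unfolding b_def by linarith+
      moreover have "min b a = a" "min (- b) a = - b"
        by (auto simp: b_def)
      ultimately show ?thesis
        by (simp add: F_def algebra_simps)
    qed
    finally show ?thesis by (simp add: a_def)
  qed
  show ?thesis
    unfolding lborel_plane_Fubini(1)[OF box_bounded_integrable(1)[OF bb]] slice by simp
qed

text \<open>
  Integration by parts along the line, on which \<open>\<phi>\<^sub>t + \<sigma> \<phi>\<^sub>x\<close> is the derivative of \<open>\<phi> (\<sigma> s, s)\<close>.
  The boundary term at \<open>s = 0\<close> vanishes together with the weight \<open>s\<close>.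
\<close>
lemma growing_delta_balance:
  assumes \<phi>: "test_function \<phi>"
  shows "(LINT s|lborel. s * (pd_t \<phi> (\<sigma> * s, s) + \<sigma> * pd_x \<phi> (\<sigma> * s, s)))
    = - (LINT s|lborel. \<phi> (\<sigma> * s, s))"
proof -
  let ?D = "\<lambda>s. pd_t \<phi> (\<sigma> * s, s) + \<sigma> * pd_x \<phi> (\<sigma> * s, s)"
  note tl = test_function_test_like[OF \<phi>]
  obtain R where R: "\<And>x t. \<phi> (x, t) \<noteq> 0 \<or> pd_x \<phi> (x, t) \<noteq> 0 \<or> pd_t \<phi> (x, t) \<noteq> 0
      \<Longrightarrow> \<bar>x\<bar> \<le> R \<and> 0 < t \<and> t \<le> R"
    using test_function_support[OF \<phi>] by blast
  have int\<phi>: "integrable lborel (\<lambda>s. \<phi> (\<sigma> * s, s))"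
    using integrable_on_line[OF tl(1), of 0 \<sigma>] by simp
  have intD: "integrable lborel (\<lambda>s. s * ?D s)"
    using Bochner_Integration.integrable_add[OF integrable_on_line[OF tl(3), of 1 \<sigma>]
        integrable_mult_right[OF integrable_on_line[OF tl(2), of 1 \<sigma>], of \<sigma>]]
    by (simp add: algebra_simps)
  have "(LINT s|lborel. \<phi> (\<sigma> * s, s) + s * ?D s)
      = (\<bar>R\<bar> + 1) * \<phi> (\<sigma> * (\<bar>R\<bar> + 1), \<bar>R\<bar> + 1) - 0 * \<phi> (\<sigma> * 0, 0)"
  proof (rule integral_of_derivative[where S="{}" and f="\<lambda>s. s * \<phi> (\<sigma> * s, s)"])
    show "((\<lambda>s. s * \<phi> (\<sigma> * s, s)) has_real_derivative \<phi> (\<sigma> * s, s) + s * ?D s) (at s)" for s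
    proof -
      have "((\<lambda>s. \<phi> (\<sigma> * s, s)) has_real_derivative ?D s) (at s)"
        using has_derivative_along_line[of \<phi> 0 \<sigma> s 0 1] test_function_differentiable[OF \<phi>]
        by (simp add: add.commute)
      from DERIV_mult[OF DERIV_ident this] show ?thesis by (simp add: mult.commute)
    qed
    then show "continuous_on {0..\<bar>R\<bar> + 1} (\<lambda>s. s * \<phi> (\<sigma> * s, s))"
      by (intro DERIV_continuous_on) (rule DERIV_subset, auto)
    show "\<phi> (\<sigma> * s, s) + s * ?D s = 0" if "s \<notin> {0..\<bar>R\<bar> + 1}" for s
    proof -
      have "\<phi> (\<sigma> * s, s) = 0 \<and> pd_x \<phi> (\<sigma> * s, s) = 0 \<and> pd_t \<phi> (\<sigma> * s, s) = 0"
        using R[of "\<sigma> * s" s] that by fastforce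
      then show ?thesis by simp
    qed
    show "integrable lborel (\<lambda>s. \<phi> (\<sigma> * s, s) + s * ?D s)"
      by (rule Bochner_Integration.integrable_add[OF int\<phi> intD])
  qed auto
  also have "\<dots> = 0"
    using R[of "\<sigma> * (\<bar>R\<bar> + 1)" "\<bar>R\<bar> + 1"] by auto
  finally show ?thesis
    using Bochner_Integration.integral_add[OF int\<phi> intD] by simp
qed

section \<open>The delta shock\<close>

lemma takes_initial_data_across_line:
  assumes "\<And>x t. x < \<sigma> * t \<Longrightarrow> f (x, t) = A" "\<And>x t. x > \<sigma> * t \<Longrightarrow> f (x, t) = C"
  shows "takes_initial_data f (riemann_data A C)"
  unfolding takes_initial_data_def
proof (intro allI impI conjI)
  fix x :: real assume x: "x \<noteq> 0"
  then show "f (x, 0) = riemann_data A C x"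
    using assms[where x=x and t=0] by (auto simp: riemann_data_def)
  have lim: "((\<lambda>t. \<sigma> * t) \<longlongrightarrow> 0) (at_right 0)"
    by (auto intro!: tendsto_eq_intros)
  have "\<forall>\<^sub>F t in at_right 0. f (x, t) = riemann_data A C x"
  proof (cases "x < 0")
    case True
    from order_tendstoD(1)[OF lim True] show ?thesis
      by eventually_elim (use True assms(1) in \<open>auto simp: riemann_data_def\<close>)
  next
    case False
    with x have "0 < x" by simp
    from order_tendstoD(2)[OF lim this] show ?thesis
      by eventually_elim (use False assms(2) in \<open>auto simp: riemann_data_def\<close>)
  qed
  then show "((\<lambda>t. f (x, t)) \<longlongrightarrow> riemann_data A C x) (at_right 0)"
    by (rule tendsto_eventually)
qed

lemma tame_velocity: "tame (velocity A C B \<sigma>)"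
proof (rule tame_bounded)
  have "(\<lambda>p. fst p - \<sigma> * snd p) \<in> borel_measurable borel"
    by (intro borel_measurable_continuous_onI continuous_intros)
  moreover have "(\<lambda>z::real. if z < 0 then A else if z = 0 then B else C) \<in> borel_measurable borel"
    by measurable
  ultimately have "(\<lambda>p. if fst p - \<sigma> * snd p < 0 then A else if fst p - \<sigma> * snd p = 0 then B else C)
      \<in> borel_measurable borel"
    by (rule measurable_compose)
  then show "velocity A C B \<sigma> \<in> borel_measurable borel"
    by (simp add: velocity_def split_def cong: if_cong)
  show "\<bar>velocity A C B \<sigma> p\<bar> \<le> \<bar>A\<bar> + \<bar>B\<bar> + \<bar>C\<bar>" for p
    by (cases p) (auto simp: velocity_def)
qed

text \<open>
  Here \<open>k\<close> stands for \<open>m t\<close>. Each side of the line is a polynomial identity in \<open>E\<close>. The terms with \<open>k\<close> cancel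
  because the delta enters the product of \<open>rb\<close> with the velocity defect and \<open>\<alpha>\<^sup>2 * rbx * ubx\<close> with
  opposite signs; the terms with \<open>E\<^sup>2\<close> of the
  step cancel likewise, and the terms linear in \<open>E\<close> cancel against those of \<open>\<rho>\<^sub>l * ub\<close> or \<open>\<rho>\<^sub>r * ub\<close>.
\<close>
lemma filtered_fluxes_cancel:
  fixes z k \<alpha> \<sigma> \<rho>\<^sub>l \<rho>\<^sub>r u\<^sub>l u\<^sub>r :: real
  defines "E \<equiv> exp (- \<bar>z\<bar> / \<alpha>)" and "W \<equiv> saturation \<alpha> z"
  defines "rb \<equiv> (\<rho>\<^sub>l + \<rho>\<^sub>r) / 2 - (\<rho>\<^sub>l - \<rho>\<^sub>r) / 2 * W + k / (2 * \<alpha>) * E"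
    and "rbx \<equiv> - (\<rho>\<^sub>l - \<rho>\<^sub>r) / (2 * \<alpha>) * E - sgn z * (k / (2 * \<alpha>\<^sup>2)) * E"
    and "ub \<equiv> \<sigma> - (u\<^sub>l - u\<^sub>r) / 2 * W" and "ubx \<equiv> - (u\<^sub>l - u\<^sub>r) / (2 * \<alpha>) * E"
  assumes "\<alpha> > 0" "\<sigma> = (u\<^sub>l + u\<^sub>r) / 2"
  shows "z < 0 \<Longrightarrow> \<rho>\<^sub>l * ub + rb * (u\<^sub>l - ub) + \<alpha>\<^sup>2 * rbx * ubx = \<rho>\<^sub>l * u\<^sub>l"
    and "z > 0 \<Longrightarrow> \<rho>\<^sub>r * ub + rb * (u\<^sub>r - ub) + \<alpha>\<^sup>2 * rbx * ubx = \<rho>\<^sub>r * u\<^sub>r"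
proof -
  assume "z < 0"
  then have *: "W = E - 1" "sgn z = - 1"
    by (auto simp: W_def E_def saturation_nonpos)
  show "\<rho>\<^sub>l * ub + rb * (u\<^sub>l - ub) + \<alpha>\<^sup>2 * rbx * ubx = \<rho>\<^sub>l * u\<^sub>l"
    unfolding rb_def rbx_def ub_def ubx_def * assms(8) using assms(7)
    by (simp add: field_simps power2_eq_square)
next
  assume "z > 0"
  then have *: "W = 1 - E" "sgn z = 1"
    by (auto simp: W_def E_def saturation_nonneg)
  show "\<rho>\<^sub>r * ub + rb * (u\<^sub>r - ub) + \<alpha>\<^sup>2 * rbx * ubx = \<rho>\<^sub>r * u\<^sub>r"
    unfolding rb_def rbx_def ub_def ubx_def * assms(8) using assms(7)
    by (simp add: field_simps power2_eq_square)
qed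

text \<open>
  This is \<open>\<rho>\<^sub>t + q\<^sub>x = 0\<close> for a density \<open>\<rho>\<close> and a flux \<open>q\<close> that are steps with values \<open>\<rho>\<^sub>l\<close>, \<open>\<rho>\<^sub>r\<close> and
  \<open>m\<^sub>l\<close>, \<open>m\<^sub>r\<close>, where the line carries a mass that grows at the rate of the Rankine-Hugoniot deficit of the steps.
  Splitting \<open>\<phi>\<^sub>t\<close> into \<open>\<phi>\<^sub>t + \<sigma> \<phi>\<^sub>x\<close> and \<open>- \<sigma> \<phi>\<^sub>x\<close> reduces it to the three integrals computed above.
\<close>
lemma delta_shock_weak_form:
  assumes \<phi>: "test_function \<phi>"
  shows "(LINT p|lborel. rho_regular \<rho>\<^sub>l \<rho>\<^sub>r \<sigma> p * pd_t \<phi> p)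
      + (LINT p|lborel. rho_regular m\<^sub>l m\<^sub>r \<sigma> p * pd_x \<phi> p)
      + ((m\<^sub>l - m\<^sub>r) - \<sigma> * (\<rho>\<^sub>l - \<rho>\<^sub>r))
        * (LINT s|lborel. s * (pd_t \<phi> (\<sigma> * s, s) + \<sigma> * pd_x \<phi> (\<sigma> * s, s))) = 0"
proof -
  note tl = test_function_test_like[OF \<phi>]
  have int: "integrable lborel (\<lambda>p. rho_regular A C \<sigma> p * \<psi> p)" if "test_like \<psi>" for A C \<psi>
    by (intro box_bounded_integrable(1) box_bounded_tame_mult tame_rho_regular that)
  have "(LINT p|lborel. rho_regular \<rho>\<^sub>l \<rho>\<^sub>r \<sigma> p * (pd_t \<phi> p + \<sigma> * pd_x \<phi> p))
      = (LINT p|lborel. rho_regular \<rho>\<^sub>l \<rho>\<^sub>r \<sigma> p * pd_t \<phi> p)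
        + \<sigma> * (LINT p|lborel. rho_regular \<rho>\<^sub>l \<rho>\<^sub>r \<sigma> p * pd_x \<phi> p)"
    using Bochner_Integration.integral_add[OF int[OF tl(3)] integrable_mult_right[OF int[OF tl(2)], of \<sigma>]]
    by (simp add: algebra_simps)
  then show ?thesis
    unfolding advected_step_is_conserved[OF \<phi>] step_flux_concentrates_on_line[OF \<phi>]
      growing_delta_balance[OF \<phi>]
    by (simp add: algebra_simps)
qed

text \<open>
  The witnesses are the explicit filtered functions and their classical \<open>x\<close>-derivatives off the line. On
  the line, where \<open>rbx\<close> jumps, \<open>sgn 0 = 0\<close> makes an immaterial choice.
\<close>
lemma density_solves_distributionally:
  fixes \<alpha> u\<^sub>l u\<^sub>r \<rho>\<^sub>l \<rho>\<^sub>r \<sigma> :: real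
  defines "m \<equiv> (\<rho>\<^sub>l * u\<^sub>l - \<rho>\<^sub>r * u\<^sub>r) - \<sigma> * (\<rho>\<^sub>l - \<rho>\<^sub>r)"
  assumes \<alpha>: "\<alpha> > 0" and \<sigma>: "\<sigma> = (u\<^sub>l + u\<^sub>r) / 2"
  shows "solves_rho_distributionally \<alpha> (helmholtz \<alpha>) (rho_regular \<rho>\<^sub>l \<rho>\<^sub>r \<sigma>)
    (\<lambda>s. s / sqrt (1 + \<sigma>\<^sup>2) * m) (\<lambda>s. \<sigma> * s) (\<lambda>s. s) {0..} (velocity u\<^sub>l u\<^sub>r \<sigma> \<sigma>) \<sigma>"
proof -
  let ?g = "helmholtz \<alpha>" and ?h = "rho_regular \<rho>\<^sub>l \<rho>\<^sub>r \<sigma>" and ?u = "velocity u\<^sub>l u\<^sub>r \<sigma> \<sigma>"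
  let ?w = "\<lambda>s. s / sqrt (1 + \<sigma>\<^sup>2) * m"
  define ub where "ub = (\<lambda>(x, t). \<sigma> - (u\<^sub>l - u\<^sub>r) / 2 * saturation \<alpha> (x - \<sigma> * t))"
  define ubx where "ubx = (\<lambda>(x, t). - (u\<^sub>l - u\<^sub>r) / (2 * \<alpha>) * exp (- \<bar>x - \<sigma> * t\<bar> / \<alpha>))"
  define hb where "hb = (\<lambda>(x, t). (\<rho>\<^sub>l + \<rho>\<^sub>r) / 2 - (\<rho>\<^sub>l - \<rho>\<^sub>r) / 2 * saturation \<alpha> (x - \<sigma> * t))"
  define rb where "rb = (\<lambda>(x, t). (\<rho>\<^sub>l + \<rho>\<^sub>r) / 2 - (\<rho>\<^sub>l - \<rho>\<^sub>r) / 2 * saturation \<alpha> (x - \<sigma> * t)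
    + m * t / (2 * \<alpha>) * exp (- \<bar>x - \<sigma> * t\<bar> / \<alpha>))"
  define rbx where "rbx = (\<lambda>(x, t). - (\<rho>\<^sub>l - \<rho>\<^sub>r) / (2 * \<alpha>) * exp (- \<bar>x - \<sigma> * t\<bar> / \<alpha>)
    - sgn (x - \<sigma> * t) * (m * t / (2 * \<alpha>\<^sup>2)) * exp (- \<bar>x - \<sigma> * t\<bar> / \<alpha>))"
  have w: "?w t * sqrt (1 + \<sigma>\<^sup>2) = m * t" for t
  proof -
    have "1 + \<sigma>\<^sup>2 > 0" by (intro add_pos_nonneg) auto
    then show ?thesis by simp
  qed
  have cont: "continuous_on UNIV ub" "continuous_on UNIV ubx" "continuous_on UNIV hb" "continuous_on UNIV rb"
    unfolding ub_def ubx_def hb_def rb_def split_def using \<alpha>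
    by (auto intro!: continuous_intros)
  have sgn_meas: "(\<lambda>p. sgn (fst p - \<sigma> * snd p)) \<in> borel_measurable borel"
    by (rule measurable_compose[OF borel_measurable_continuous_onI borel_measurable_sgn])
       (intro continuous_intros)
  have tame_sgn: "tame (\<lambda>p. sgn (fst p - \<sigma> * snd p))"
    by (rule tame_bounded[OF sgn_meas, of 1]) (simp add: sgn_if)
  have tame_E: "tame (\<lambda>p. - (\<rho>\<^sub>l - \<rho>\<^sub>r) / (2 * \<alpha>) * exp (- \<bar>fst p - \<sigma> * snd p\<bar> / \<alpha>))"
    "tame (\<lambda>p. m * snd p / (2 * \<alpha>\<^sup>2) * exp (- \<bar>fst p - \<sigma> * snd p\<bar> / \<alpha>))"
    using \<alpha> by (auto intro!: tame_continuous continuous_intros)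
  have "tame (\<lambda>p. - (\<rho>\<^sub>l - \<rho>\<^sub>r) / (2 * \<alpha>) * exp (- \<bar>fst p - \<sigma> * snd p\<bar> / \<alpha>)
      - sgn (fst p - \<sigma> * snd p) * (m * snd p / (2 * \<alpha>\<^sup>2) * exp (- \<bar>fst p - \<sigma> * snd p\<bar> / \<alpha>)))"
    by (rule tame_diff[OF tame_E(1) tame_mult[OF tame_sgn tame_E(2)]])
  then have tame_rbx: "tame rbx"
    by (simp add: rbx_def split_def mult.assoc)
  note tame = cont[THEN tame_continuous] tame_rbx tame_rho_regular[of \<rho>\<^sub>l \<rho>\<^sub>r \<sigma>]
    tame_velocity[of u\<^sub>l u\<^sub>r \<sigma> \<sigma>]
  have tame_flux: "tame (\<lambda>p. ?h p * ub p)" "tame (\<lambda>p. rb p * (?u p - ub p))"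
    "tame (\<lambda>p. \<alpha>\<^sup>2 * rbx p * ubx p)"
    by (intro tame_mult tame_diff tame_const tame)+
  have conv_u: "conv_x ?g ?u = ub"
    unfolding ub_def by (rule conv_x_velocity[OF \<alpha> \<sigma>])
  have conv_h: "conv_x ?g ?h = hb"
  proof (intro ext, clarify)
    fix x t
    have "(\<lambda>y. ?h (y, t)) \<in> borel_measurable borel"
      using tame(6) by (intro measurable_slices) (simp add: tame_def)
    then show "conv_x ?g ?h (x, t) = hb (x, t)"
      unfolding hb_def using conv_x_helmholtz_step[OF \<alpha>, of ?h t "\<sigma> * t" \<rho>\<^sub>l \<rho>\<^sub>r x]
      by (simp add: rho_regular_def)
  qed
  have filtered: "represents_conv_x ?g (rho_pairing ?h ?w (\<lambda>s. \<sigma> * s) (\<lambda>s. s) {0..}) rb"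
  proof -
    have R: "rb = (\<lambda>(x, t). conv_x ?g ?h (x, t) + ?w t * sqrt (1 + \<sigma>\<^sup>2) * ?g (x - \<sigma> * t))"
      unfolding w conv_h by (auto simp: rb_def hb_def helmholtz_def fun_eq_iff)
    show ?thesis
      unfolding R
    proof (rule represents_conv_x_rho)
      show "integrable lborel ?g"
        using helmholtz_mass[OF \<alpha>] by (rule integrable.intros)
      show "?h \<in> borel_measurable borel" using tame(6) by (simp add: tame_def)
      show "\<bar>?h p\<bar> \<le> max \<bar>\<rho>\<^sub>l\<bar> \<bar>\<rho>\<^sub>r\<bar>" for p
        by (cases p) (auto simp: rho_regular_def)
      show "tame (conv_x ?g ?h)" unfolding conv_h by (rule tame)
      show "tame (\<lambda>(x, t). ?w t * sqrt (1 + \<sigma>\<^sup>2) * ?g (x - \<sigma> * t))"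
        unfolding w helmholtz_def split_def using \<alpha>
        by (auto intro!: tame_continuous continuous_intros)
    qed
  qed
  have weak_u: "weak_pd_x ub ubx"
  proof (rule weak_pd_x_of_piecewise_derivative[OF cont(1) tame(2), where c="\<lambda>t. \<sigma> * t"])
    fix x t assume "x \<noteq> \<sigma> * t"
    then have "((\<lambda>x. saturation \<alpha> (x - \<sigma> * t)) has_real_derivative
        exp (- \<bar>x - \<sigma> * t\<bar> / \<alpha>) / \<alpha>) (at x)"
      using saturation_has_derivative[of "x - \<sigma> * t" \<alpha>]
        DERIV_shift[of "saturation \<alpha>" _ x "- (\<sigma> * t)"] by simp
    from DERIV_diff[OF DERIV_const[of \<sigma>] DERIV_cmult[OF this, of "(u\<^sub>l - u\<^sub>r) / 2"]]
    show "((\<lambda>x. ub (x, t)) has_real_derivative ubx (x, t)) (at x)"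
      unfolding ub_def ubx_def prod.case
      by (rule DERIV_cong) (use \<alpha> in \<open>simp add: field_simps\<close>)
  qed
  have weak_r: "weak_pd_x rb rbx"
  proof (rule weak_pd_x_of_piecewise_derivative[OF cont(4) tame(5), where c="\<lambda>t. \<sigma> * t"])
    fix x t assume x: "x \<noteq> \<sigma> * t"
    then have W: "((\<lambda>x. saturation \<alpha> (x - \<sigma> * t)) has_real_derivative
        exp (- \<bar>x - \<sigma> * t\<bar> / \<alpha>) / \<alpha>) (at x)"
      using saturation_has_derivative[of "x - \<sigma> * t" \<alpha>]
        DERIV_shift[of "saturation \<alpha>" _ x "- (\<sigma> * t)"] by simp
    have E: "((\<lambda>x. exp (- \<bar>x - \<sigma> * t\<bar> / \<alpha>)) has_real_derivative
        - sgn (x - \<sigma> * t) * exp (- \<bar>x - \<sigma> * t\<bar> / \<alpha>) / \<alpha>) (at x)"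
      using x exp_abs_has_derivative[of "x - \<sigma> * t" \<alpha>]
        DERIV_shift[of "\<lambda>z. exp (- \<bar>z\<bar> / \<alpha>)" _ x "- (\<sigma> * t)"] by simp
    from DERIV_add[OF DERIV_diff[OF DERIV_const[of "(\<rho>\<^sub>l + \<rho>\<^sub>r) / 2"] DERIV_cmult[OF W, of "(\<rho>\<^sub>l - \<rho>\<^sub>r) / 2"]]
        DERIV_cmult[OF E, of "m * t / (2 * \<alpha>)"]]
    show "((\<lambda>x. rb (x, t)) has_real_derivative rbx (x, t)) (at x)"
      unfolding rb_def rbx_def prod.case
      by (rule DERIV_cong) (use \<alpha> in \<open>simp add: field_simps power2_eq_square\<close>)
  qed
  have equation: "rho_pairing ?h ?w (\<lambda>s. \<sigma> * s) (\<lambda>s. s) {0..} (pd_t \<phi>)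
      + rho_ubar_pairing ?h ?w (\<lambda>s. \<sigma> * s) (\<lambda>s. s) {0..} ub \<sigma> (pd_x \<phi>)
      + fun_pairing (\<lambda>p. rb p * (?u p - ub p)) (pd_x \<phi>)
      + fun_pairing (\<lambda>p. \<alpha>\<^sup>2 * rbx p * ubx p) (pd_x \<phi>) = 0"
    if \<phi>: "test_function \<phi>" for \<phi>
  proof -
    note tl = test_function_test_like[OF \<phi>]
    have pos: "pd_x \<phi> (x, t) \<noteq> 0 \<Longrightarrow> t > 0" "pd_t \<phi> (x, t) \<noteq> 0 \<Longrightarrow> t > 0" for x t
      using tl by (auto simp: test_like_def)
    note bb = tame_flux[THEN box_bounded_tame_mult, OF tl(2)]
    note int = bb[THEN box_bounded_integrable(1)]
    let ?q = "rho_regular (\<rho>\<^sub>l * u\<^sub>l) (\<rho>\<^sub>r * u\<^sub>r) \<sigma>"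
    have "fun_pairing (\<lambda>p. ?h p * ub p) (pd_x \<phi>) + fun_pairing (\<lambda>p. rb p * (?u p - ub p)) (pd_x \<phi>)
        + fun_pairing (\<lambda>p. \<alpha>\<^sup>2 * rbx p * ubx p) (pd_x \<phi>)
      = (LINT p|lborel. ?h p * ub p * pd_x \<phi> p + rb p * (?u p - ub p) * pd_x \<phi> p
          + \<alpha>\<^sup>2 * rbx p * ubx p * pd_x \<phi> p)"
      using fun_pairing_eq[of "pd_x \<phi>", OF pos(1)] int
      by (simp add: Bochner_Integration.integral_add)
    also have "\<dots> = (LINT p|lborel. ?q p * pd_x \<phi> p)"
    proof (rule integral_eq_off_line[where \<sigma>=\<sigma>])
      show "box_bounded (\<lambda>p. ?h p * ub p * pd_x \<phi> p + rb p * (?u p - ub p) * pd_x \<phi> p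
          + \<alpha>\<^sup>2 * rbx p * ubx p * pd_x \<phi> p)"
        by (intro box_bounded_add bb)
      show "box_bounded (\<lambda>p. ?q p * pd_x \<phi> p)"
        by (intro box_bounded_tame_mult tame_rho_regular tl)
      fix x t assume off: "x \<noteq> \<sigma> * t"
      have "?h (x, t) * ub (x, t) + rb (x, t) * (?u (x, t) - ub (x, t))
          + \<alpha>\<^sup>2 * rbx (x, t) * ubx (x, t) = ?q (x, t)"
      proof (cases "x < \<sigma> * t")
        case True
        then have "x - \<sigma> * t < 0" by simp
        from filtered_fluxes_cancel(1)[OF \<alpha> \<sigma> this, where k="m * t"] True show ?thesis
          unfolding ub_def rb_def rbx_def ubx_def prod.case by (simp add: rho_regular_def velocity_def)
      next
        case False
        with off have "x - \<sigma> * t > 0" by simp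
        from filtered_fluxes_cancel(2)[OF \<alpha> \<sigma> this, where k="m * t"] False off show ?thesis
          unfolding ub_def rb_def rbx_def ubx_def prod.case by (simp add: rho_regular_def velocity_def)
      qed
      then show "?h (x, t) * ub (x, t) * pd_x \<phi> (x, t) + rb (x, t) * (?u (x, t) - ub (x, t)) * pd_x \<phi> (x, t)
          + \<alpha>\<^sup>2 * rbx (x, t) * ubx (x, t) * pd_x \<phi> (x, t) = ?q (x, t) * pd_x \<phi> (x, t)"
        by (simp flip: distrib_right)
    qed
    finally have flux: "fun_pairing (\<lambda>p. ?h p * ub p) (pd_x \<phi>)
        + fun_pairing (\<lambda>p. rb p * (?u p - ub p)) (pd_x \<phi>)
        + fun_pairing (\<lambda>p. \<alpha>\<^sup>2 * rbx p * ubx p) (pd_x \<phi>) = (LINT p|lborel. ?q p * pd_x \<phi> p)" .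
    have int_line: "integrable lborel (\<lambda>s. s * \<psi> (\<sigma> * s, s))" if "test_like \<psi>" for \<psi>
      using integrable_on_line[OF that, of 1 \<sigma>] by simp
    have "weighted_delta ?w (\<lambda>s. \<sigma> * s) (\<lambda>s. s) {0..} (pd_t \<phi>)
        + weighted_delta (\<lambda>s. ?w s * \<sigma>) (\<lambda>s. \<sigma> * s) (\<lambda>s. s) {0..} (pd_x \<phi>)
      = (LINT s|lborel. m * (s * pd_t \<phi> (\<sigma> * s, s))) + (LINT s|lborel. m * \<sigma> * (s * pd_x \<phi> (\<sigma> * s, s)))"
    proof -
      have "?w s * \<sigma> * sqrt (1 + \<sigma>\<^sup>2) = m * s * \<sigma>" for s
        unfolding w[of s, symmetric] by (simp only: mult_ac)
      then show ?thesis
        using weighted_delta_line[of "pd_t \<phi>" ?w \<sigma>, OF pos(2)]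
          weighted_delta_line[of "pd_x \<phi>" "\<lambda>s. ?w s * \<sigma>" \<sigma>, OF pos(1)] w
        by (simp add: mult_ac)
    qed
    also have "\<dots> = m * (LINT s|lborel. s * (pd_t \<phi> (\<sigma> * s, s) + \<sigma> * pd_x \<phi> (\<sigma> * s, s)))"
    proof -
      have "(LINT s|lborel. s * (pd_t \<phi> (\<sigma> * s, s) + \<sigma> * pd_x \<phi> (\<sigma> * s, s)))
          = (LINT s|lborel. s * pd_t \<phi> (\<sigma> * s, s)) + \<sigma> * (LINT s|lborel. s * pd_x \<phi> (\<sigma> * s, s))"
        using Bochner_Integration.integral_add[OF int_line[OF tl(3)]
            integrable_mult_right[OF int_line[OF tl(2)], of \<sigma>]]
        by (simp add: distrib_left mult.left_commute[of _ \<sigma>])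
      then show ?thesis
        by (simp add: distrib_left mult.assoc)
    qed
    finally show ?thesis
      using delta_shock_weak_form[OF \<phi>, of \<rho>\<^sub>l \<rho>\<^sub>r \<sigma> "\<rho>\<^sub>l * u\<^sub>l" "\<rho>\<^sub>r * u\<^sub>r"] flux
        fun_pairing_eq[of "pd_t \<phi>" ?h, OF pos(2)]
      unfolding rho_pairing_def rho_ubar_pairing_def m_def[symmetric] by simp
  qed
  show ?thesis
    unfolding solves_rho_distributionally_def Let_def conv_u
  proof (rule conjI[OF _ exI[of _ rb, OF exI[of _ rbx, OF exI[of _ ubx]]]], goal_cases)
    case 1
    show ?case by (simp add: ub_def)
  next
    case 2
    show ?case
      using filtered tame_loc_bounded[OF tame(4)] weak_r weak_u tame_loc_integrable[OF tame(6)]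
        tame_flux[THEN tame_loc_integrable] equation
      by blast
  qed
qed

theorem theorem3:
  fixes \<alpha> u\<^sub>l u\<^sub>r \<rho>\<^sub>l \<rho>\<^sub>r \<sigma> u\<^sub>\<delta> :: real
    and g w X T :: "real \<Rightarrow> real"
    and h u :: "real \<times> real \<Rightarrow> real"
  assumes "\<alpha> > 0" and "\<rho>\<^sub>l \<ge> 0" and "\<rho>\<^sub>r \<ge> 0"
    and "u\<^sub>l > u\<^sub>r"
    and "\<sigma> = (u\<^sub>l + u\<^sub>r) / 2" and "\<sigma> \<in> {u\<^sub>r<..<u\<^sub>l}"
    and "(\<rho>\<^sub>l * u\<^sub>l - \<rho>\<^sub>r * u\<^sub>r) - \<sigma> * (\<rho>\<^sub>l - \<rho>\<^sub>r) > 0"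
    and "g = helmholtz \<alpha>"
    and "u\<^sub>\<delta> = \<sigma>"
    and "h = rho_regular \<rho>\<^sub>l \<rho>\<^sub>r \<sigma>"
    and "w = (\<lambda>s. s / sqrt (1 + \<sigma>\<^sup>2) * ((\<rho>\<^sub>l * u\<^sub>l - \<rho>\<^sub>r * u\<^sub>r) - \<sigma> * (\<rho>\<^sub>l - \<rho>\<^sub>r)))"
    and "X = (\<lambda>s. \<sigma> * s)" and "T = (\<lambda>s. s)"
    and "u = velocity u\<^sub>l u\<^sub>r u\<^sub>\<delta> \<sigma>"
  shows "solves_u_by_characteristics g u
    \<and> takes_initial_data u (riemann_data u\<^sub>l u\<^sub>r)
    \<and> solves_rho_distributionally \<alpha> g h w X T {0..} u u\<^sub>\<delta>
    \<and> takes_initial_data h (riemann_data \<rho>\<^sub>l \<rho>\<^sub>r) \<and> w 0 = 0"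
proof (intro conjI)
  show "solves_u_by_characteristics g u"
    unfolding assms(8,14)
    by (rule velocity_solves_by_characteristics[OF assms(1) less_imp_le[OF assms(4)] assms(5)])
  show "takes_initial_data u (riemann_data u\<^sub>l u\<^sub>r)"
    unfolding assms(14) by (rule takes_initial_data_across_line[of \<sigma>]) (auto simp: velocity_def)
  show "solves_rho_distributionally \<alpha> g h w X T {0..} u u\<^sub>\<delta>"
    unfolding assms(8-14) by (rule density_solves_distributionally[OF assms(1,5)])
  show "takes_initial_data h (riemann_data \<rho>\<^sub>l \<rho>\<^sub>r)"
    unfolding assms(10) by (rule takes_initial_data_across_line[of \<sigma>]) (auto simp: rho_regular_def)
  show "w 0 = 0"
    unfolding assms(11) by simp
qed

end
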